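(* $P^+_{\mathfrak b_{(2)}}=\{\lambda\in\mathfrak h^*\mid \lambda_2\in\mathbb Z_{\ge 1}\}\cup\{0\}$, and $\dim K_{\mathfrak b_{(2)}}(\lambda)=4\lambda_2$ for all $\lambda\in P^+_{\mathfrak b_{(2)}}\setminus\{0\}$.
   Context: All vector spaces are over $\mathbb C$. $\mathfrak g=\mathfrak{sl}(1|2)$ is the Lie superalgebra of $3\times 3$ complex matrices $A=(a_{ij})$ with $a_{11}-a_{22}-a_{33}=0$; the even part consists of block-diagonal matrices (blocks of size $1$ and $2$), the odd part of block-off-diagonal matrices, and $[A,B]=AB-(-1)^{\bar i\bar j}BA$ for $A,B$ of parity $\bar i,\bar j$. Let $E_{i,j}$ be the matrix units, $x_1=E_{1,2}$, $x_2=E_{2,3}$, $x_3=E_{1,3}$, $y_i=x_i^t$ (transpose), $h_1=E_{1,1}+E_{2,2}$, $h_2=E_{2,2}-E_{3,3}$. The Cartan subalgebra is $\mathfrak h=\mathrm{span}\{h_1,h_2\}$. For $\lambda\in\mathfrak h^*$ write $\lambda_i=\lambda(h_i)$. The Borel subalgebra $\mathfrak b_{(2)}=\mathfrak h\oplus\mathfrak n^+$ has $\mathfrak n^+=\mathrm{span}\{y_1,x_2,x_3\}$. $P^+_{\mathfrak b_{(2)}}$ is the set of $\lambda\in\mathfrak h^*$ such that the irreducible $\mathfrak g$-module of highest weight $\lambda$ with respect to $\mathfrak b_{(2)}$ is finite dimensional. For $\lambda\in P^+_{\mathfrak b_{(2)}}$, the generalized Kac module $K_{\mathfrak b_{(2)}}(\lambda)$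 is the quotient of the universal enveloping superalgebra $\mathbf U(\mathfrak g)$ by the left ideal generated by $\mathfrak n^+$, $h-\lambda(h)$ ($h\in\mathfrak h$) and $y_2^{\lambda_2+1}$. *)

theory Defs
  imports
    "HOL-Analysis.Analysis"
    "HOL-Library.Poly_Mapping"
    "HOL-Library.Z2"
    "Jordan_Normal_Form.Missing_VectorSpace"
begin

unbundle no fps_syntax

section \<open>The Lie superalgebra sl(1|2)\<close>

text \<open>Parities are elements of \<^typ>\<open>bit\<close>, the field with two elements.  Row and column 1 of a matrix
  are even, rows and columns 2 and 3 are odd.\<close>

definition index_parity :: "3 \<Rightarrow> bit" where
  "index_parity i = (if i = 1 then 0 else 1)"

definition super_sign :: "bit \<Rightarrow> bit \<Rightarrow> complex" where
  "super_sign p q = (if p = 1 \<and> q = 1 then - 1 else 1)"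

definition mat_scale :: "complex \<Rightarrow> complex^3^3 \<Rightarrow> complex^3^3" where
  "mat_scale c A = (\<chi> i j. c * A $ i $ j)"

definition mat_component :: "bit \<Rightarrow> complex^3^3 \<Rightarrow> complex^3^3" where
  "mat_component p A = (\<chi> i j. if index_parity i + index_parity j = p then A $ i $ j else 0)"

text \<open>The bilinear extension of \<open>[A, B] = AB - (-1)\<^sup>p\<^sup>q BA\<close> for \<open>A\<close>, \<open>B\<close> of parities \<open>p\<close>, \<open>q\<close>.\<close>

definition mat_superbracket :: "complex^3^3 \<Rightarrow> complex^3^3 \<Rightarrow> complex^3^3" where
  "mat_superbracket A B = (\<Sum>p\<in>{0, 1}. \<Sum>q\<in>{0, 1}.
     mat_component p A ** mat_component q B
       - mat_scale (super_sign p q) (mat_component q B ** mat_component p A))"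

definition mat_unit :: "3 \<Rightarrow> 3 \<Rightarrow> complex^3^3" where
  "mat_unit i j = (\<chi> k l. if k = i \<and> l = j then 1 else 0)"

typedef sl12 = "{A :: complex^3^3. A $ 1 $ 1 - A $ 2 $ 2 - A $ 3 $ 3 = 0}"
  morphisms mat_of_sl12 Abs_sl12
  by (rule exI[of _ 0]) simp

setup_lifting type_definition_sl12

instantiation sl12 :: ab_group_add
begin

lift_definition zero_sl12 :: sl12 is 0 by simp
lift_definition plus_sl12 :: "sl12 \<Rightarrow> sl12 \<Rightarrow> sl12" is "(+)" by (simp add: algebra_simps)
lift_definition uminus_sl12 :: "sl12 \<Rightarrow> sl12" is uminus by (simp add: algebra_simps)
lift_definition minus_sl12 :: "sl12 \<Rightarrow> sl12 \<Rightarrow> sl12" is "(-)" by (simp add: algebra_simps)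

instance by standard (transfer; simp)+

end

lift_definition scale_sl12 :: "complex \<Rightarrow> sl12 \<Rightarrow> sl12" is mat_scale
  by (simp add: mat_scale_def flip: right_diff_distrib)

global_interpretation sl12: vector_space scale_sl12
  by standard (transfer; simp add: mat_scale_def vec_eq_iff algebra_simps)+

lift_definition superbracket :: "sl12 \<Rightarrow> sl12 \<Rightarrow> sl12" is mat_superbracket
  by (simp add: mat_superbracket_def mat_component_def mat_scale_def super_sign_def
      index_parity_def matrix_matrix_mult_def sum_3 algebra_simps)

definition sl12_homogeneous :: "bit \<Rightarrow> sl12 set" where
  "sl12_homogeneous p =
     {x. \<forall>i j. index_parity i + index_parity j \<noteq> p \<longrightarrow> mat_of_sl12 x $ i $ j = 0}"

lift_definition X1 :: sl12 is "mat_unit 1 2" by (simp add: mat_unit_def)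
lift_definition X2 :: sl12 is "mat_unit 2 3" by (simp add: mat_unit_def)
lift_definition X3 :: sl12 is "mat_unit 1 3" by (simp add: mat_unit_def)
lift_definition Y1 :: sl12 is "transpose (mat_unit 1 2)" by (simp add: mat_unit_def transpose_def)
lift_definition Y2 :: sl12 is "transpose (mat_unit 2 3)" by (simp add: mat_unit_def transpose_def)
lift_definition Y3 :: sl12 is "transpose (mat_unit 1 3)" by (simp add: mat_unit_def transpose_def)
lift_definition H1 :: sl12 is "mat_unit 1 1 + mat_unit 2 2" by (simp add: mat_unit_def)
lift_definition H2 :: sl12 is "mat_unit 2 2 - mat_unit 3 3" by (simp add: mat_unit_def)

definition cartan :: "sl12 set" where
  "cartan = sl12.span {H1, H2}"

definition n_plus :: "sl12 set" where
  "n_plus = sl12.span {Y1, X2, X3}"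

text \<open>Linear functionals on the Cartan subalgebra, made total by the convention of
  \<^const>\<open>extensional\<close>; \<open>zero_weight\<close> is the zero functional.\<close>

definition weights :: "(sl12 \<Rightarrow> complex) set" where
  "weights = {\<mu> \<in> extensional cartan.
     (\<forall>x\<in>cartan. \<forall>y\<in>cartan. \<mu> (x + y) = \<mu> x + \<mu> y) \<and>
     (\<forall>c. \<forall>x\<in>cartan. \<mu> (scale_sl12 c x) = c * \<mu> x)}"

definition zero_weight :: "sl12 \<Rightarrow> complex" where
  "zero_weight = (\<lambda>h\<in>cartan. 0)"


section \<open>The universal enveloping superalgebra\<close>

datatype 'a free_word = Free_Word (letters: "'a list")

instantiation free_word :: (type) monoid_add
begin

definition zero_free_word :: "'a free_word" where
  "zero_free_word = Free_Word []"

definition plus_free_word :: "'a free_word \<Rightarrow> 'a free_word \<Rightarrow> 'a free_word" where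
  "plus_free_word v w = Free_Word (letters v @ letters w)"

instance by standard (simp_all add: zero_free_word_def plus_free_word_def)

end

text \<open>The monoid algebra of words, with the convolution product of \<^type>\<open>poly_mapping\<close>, is the free
  associative algebra on the underlying set of sl(1|2).  Imposing the two linearity relations turns
  it into the tensor algebra of the vector space sl(1|2).\<close>

type_synonym free_algebra = "sl12 free_word \<Rightarrow>\<^sub>0 complex"

definition free_gen :: "sl12 \<Rightarrow> free_algebra" where
  "free_gen x = Poly_Mapping.single (Free_Word [x]) 1"

definition free_scalar :: "complex \<Rightarrow> free_algebra" where
  "free_scalar c = Poly_Mapping.single 0 c"

definition uea_relations :: "free_algebra set" where
  "uea_relations =
     {free_gen (x + y) - free_gen x - free_gen y | x y. True} \<union>
     {free_gen (scale_sl12 c x) - free_scalar c * free_gen x | c x. True} \<union>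
     {free_gen x * free_gen y - free_scalar (super_sign p q) * free_gen y * free_gen x
        - free_gen (superbracket x y) | x y p q. x \<in> sl12_homogeneous p \<and> y \<in> sl12_homogeneous q}"

definition two_sided_ideal :: "'a::ring_1 set \<Rightarrow> bool" where
  "two_sided_ideal I \<longleftrightarrow> 0 \<in> I \<and> (\<forall>a\<in>I. \<forall>b\<in>I. a + b \<in> I) \<and>
     (\<forall>a\<in>I. \<forall>r. r * a \<in> I \<and> a * r \<in> I)"

definition left_ideal :: "'a::ring_1 set \<Rightarrow> bool" where
  "left_ideal I \<longleftrightarrow> 0 \<in> I \<and> (\<forall>a\<in>I. \<forall>b\<in>I. a + b \<in> I) \<and> (\<forall>a\<in>I. \<forall>r. r * a \<in> I)"

definition uea_ideal :: "free_algebra set" where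
  "uea_ideal = two_sided_ideal hull uea_relations"

lemma two_sided_ideal_uea_ideal: "two_sided_ideal uea_ideal"
  unfolding uea_ideal_def by (rule hull_in) (auto simp: two_sided_ideal_def)

lemma uea_ideal_zero: "0 \<in> uea_ideal"
  using two_sided_ideal_uea_ideal unfolding two_sided_ideal_def by blast

lemma uea_ideal_uminus:
  assumes "a \<in> uea_ideal"
  shows "- a \<in> uea_ideal"
proof -
  have "- 1 * a \<in> uea_ideal"
    using assms two_sided_ideal_uea_ideal unfolding two_sided_ideal_def by blast
  then show ?thesis by simp
qed

lemma uea_ideal_add: "a \<in> uea_ideal \<Longrightarrow> b \<in> uea_ideal \<Longrightarrow> a + b \<in> uea_ideal"
  using two_sided_ideal_uea_ideal unfolding two_sided_ideal_def by blast

lemma uea_ideal_mult: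
  assumes "a - a' \<in> uea_ideal" "b - b' \<in> uea_ideal"
  shows "a * b - a' * b' \<in> uea_ideal"
proof -
  have "a * b - a' * b' = (a - a') * b + a' * (b - b')"
    by (simp add: algebra_simps)
  with assms show ?thesis
    using two_sided_ideal_uea_ideal by (simp add: two_sided_ideal_def)
qed

lemma lookup_times_empty_word:
  fixes p q :: "'a free_word \<Rightarrow>\<^sub>0 complex"
  shows "Poly_Mapping.lookup (p * q) 0 = Poly_Mapping.lookup p 0 * Poly_Mapping.lookup q 0"
proof -
  have split: "0 = k + l \<longleftrightarrow> k = 0 \<and> l = 0" for k l :: "'a free_word"
    by (cases k; cases l) (auto simp: zero_free_word_def plus_free_word_def)
  have "Sum_any (\<lambda>l'. Poly_Mapping.lookup q l' when 0 = l + l') = (Poly_Mapping.lookup q 0 when l = 0)" for l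
    by (cases "l = 0") (simp_all add: split)
  then show ?thesis
    by (simp add: lookup_mult mult_when)
qed

lemma one_notin_uea_ideal: "1 \<notin> uea_ideal"
proof -
  have gen: "Poly_Mapping.lookup (free_gen x) 0 = 0" for x
    by (simp add: free_gen_def lookup_single zero_free_word_def)
  let ?A = "{p :: free_algebra. Poly_Mapping.lookup p 0 = 0}"
  have "two_sided_ideal ?A"
    by (simp add: two_sided_ideal_def lookup_add lookup_times_empty_word)
  moreover have "uea_relations \<subseteq> ?A"
    by (auto simp: uea_relations_def lookup_times_empty_word lookup_minus gen)
  ultimately have "uea_ideal \<subseteq> ?A"
    unfolding uea_ideal_def by (rule hull_minimal[rotated])
  then show ?thesis by (auto simp: lookup_one)
qed

quotient_type uea = free_algebra / "\<lambda>a b. a - b \<in> uea_ideal"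
  morphisms rep_uea abs_uea
proof (rule equivpI)
  show "reflp (\<lambda>a b. a - b \<in> uea_ideal)"
    using two_sided_ideal_uea_ideal by (auto simp: reflp_def two_sided_ideal_def)
  show "symp (\<lambda>a b. a - b \<in> uea_ideal)"
    by (rule sympI, drule uea_ideal_uminus) simp
  show "transp (\<lambda>a b. a - b \<in> uea_ideal)"
    by (rule transpI, drule (1) uea_ideal_add) simp
qed

instantiation uea :: ring_1
begin

lift_definition zero_uea :: uea is 0 .
lift_definition one_uea :: uea is 1 .
lift_definition plus_uea :: "uea \<Rightarrow> uea \<Rightarrow> uea" is "(+)"
  by (drule (1) uea_ideal_add) (simp add: algebra_simps)
lift_definition uminus_uea :: "uea \<Rightarrow> uea" is uminus
  by (drule uea_ideal_uminus) (simp add: algebra_simps)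
lift_definition minus_uea :: "uea \<Rightarrow> uea \<Rightarrow> uea" is "(-)"
  by (drule uea_ideal_uminus, drule (1) uea_ideal_add, drule uea_ideal_uminus)
    (simp add: algebra_simps)
lift_definition times_uea :: "uea \<Rightarrow> uea \<Rightarrow> uea" is "(*)"
  by (rule uea_ideal_mult)

instance
proof
  fix a b c :: uea
  show "a + b + c = a + (b + c)" by transfer (simp add: uea_ideal_zero add.assoc)
  show "a + b = b + a" by transfer (simp add: uea_ideal_zero add.commute)
  show "0 + a = a" by transfer (simp add: uea_ideal_zero)
  show "- a + a = 0" by transfer (simp add: uea_ideal_zero)
  show "a - b = a + - b" by transfer (simp add: uea_ideal_zero)
  show "a * b * c = a * (b * c)" by transfer (simp add: uea_ideal_zero mult.assoc)
  show "1 * a = a" by transfer (simp add: uea_ideal_zero)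
  show "a * 1 = a" by transfer (simp add: uea_ideal_zero)
  show "(a + b) * c = a * c + b * c" by transfer (simp add: uea_ideal_zero distrib_right)
  show "a * (b + c) = a * b + a * c" by transfer (simp add: uea_ideal_zero distrib_left)
  show "(0::uea) \<noteq> 1"
  proof (transfer, rule notI)
    assume "(0::free_algebra) - 1 \<in> uea_ideal"
    then have "- (0 - 1 :: free_algebra) \<in> uea_ideal" by (rule uea_ideal_uminus)
    then show False using one_notin_uea_ideal by simp
  qed
qed

end

lift_definition uea_gen :: "sl12 \<Rightarrow> uea" is free_gen .
lift_definition uea_scalar :: "complex \<Rightarrow> uea" is free_scalar .

inductive uea_homogeneous :: "bit \<Rightarrow> uea \<Rightarrow> bool" where
  zero: "uea_homogeneous p 0"
| one: "uea_homogeneous 0 1"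
| gen: "x \<in> sl12_homogeneous p \<Longrightarrow> uea_homogeneous q u \<Longrightarrow> uea_homogeneous (p + q) (uea_gen x * u)"
| add: "uea_homogeneous p u \<Longrightarrow> uea_homogeneous p v \<Longrightarrow> uea_homogeneous p (u + v)"
| scale: "uea_homogeneous p u \<Longrightarrow> uea_homogeneous p (uea_scalar c * u)"


section \<open>Modules over sl(1|2)\<close>

abbreviation complex_ring :: "complex ring" where
  "complex_ring \<equiv> \<lparr>carrier = UNIV, mult = (*), one = 1, zero = 0, add = (+)\<rparr>"

text \<open>The fields \<^const>\<open>mult\<close> and \<^const>\<open>one\<close>, which every HOL-Algebra module record carries, play no
  role.\<close>

record 'v supermodule = "(complex, 'v) module" +
  act :: "sl12 \<Rightarrow> 'v \<Rightarrow> 'v"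
  component :: "bit \<Rightarrow> 'v set"

locale sl12_module = vectorspace complex_ring M for M :: "'v supermodule" (structure) +
  assumes component_subspace: "VectorSpace.subspace complex_ring (component M p) M"
    and component_decomposition:
      "v \<in> carrier M \<Longrightarrow> \<exists>!(v0, v1). v0 \<in> component M 0 \<and> v1 \<in> component M 1 \<and> v = v0 \<oplus> v1"
    and act_closed: "v \<in> carrier M \<Longrightarrow> act M x v \<in> carrier M"
    and act_add: "v \<in> carrier M \<Longrightarrow> w \<in> carrier M \<Longrightarrow> act M x (v \<oplus> w) = act M x v \<oplus> act M x w"
    and act_smult: "v \<in> carrier M \<Longrightarrow> act M x (c \<odot> v) = c \<odot> act M x v"
    and act_add_left: "v \<in> carrier M \<Longrightarrow> act M (x + y) v = act M x v \<oplus> act M y v"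
    and act_scale_left: "v \<in> carrier M \<Longrightarrow> act M (scale_sl12 c x) v = c \<odot> act M x v"
    and act_parity:
      "x \<in> sl12_homogeneous p \<Longrightarrow> v \<in> component M q \<Longrightarrow> act M x v \<in> component M (p + q)"
    and act_superbracket:
      "x \<in> sl12_homogeneous p \<Longrightarrow> y \<in> sl12_homogeneous q \<Longrightarrow> v \<in> carrier M \<Longrightarrow>
         act M (superbracket x y) v
           = act M x (act M y v) \<ominus> super_sign p q \<odot> act M y (act M x v)"

definition sl12_submodule :: "'v supermodule \<Rightarrow> 'v set \<Rightarrow> bool" where
  "sl12_submodule M N \<longleftrightarrow> VectorSpace.subspace complex_ring N M \<and>
     (\<forall>x. \<forall>v\<in>N. act M x v \<in> N) \<and>
     (\<forall>v\<in>N. \<exists>v0 \<in> N \<inter> component M 0. \<exists>v1 \<in> N \<inter> component M 1. v = v0 \<oplus>\<^bsub>M\<^esub> v1)"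

definition irreducible_module :: "'v supermodule \<Rightarrow> bool" where
  "irreducible_module M \<longleftrightarrow> sl12_module M \<and> carrier M \<noteq> {\<zero>\<^bsub>M\<^esub>} \<and>
     (\<forall>N. sl12_submodule M N \<longrightarrow> N = {\<zero>\<^bsub>M\<^esub>} \<or> N = carrier M)"

definition highest_weight_vector :: "'v supermodule \<Rightarrow> (sl12 \<Rightarrow> complex) \<Rightarrow> 'v \<Rightarrow> bool" where
  "highest_weight_vector M \<mu> v \<longleftrightarrow> v \<in> carrier M \<and> v \<noteq> \<zero>\<^bsub>M\<^esub> \<and>
     (\<forall>x\<in>n_plus. act M x v = \<zero>\<^bsub>M\<^esub>) \<and> (\<forall>h\<in>cartan. act M h v = \<mu> h \<odot>\<^bsub>M\<^esub> v)"

definition highest_weight_module :: "'v supermodule \<Rightarrow> (sl12 \<Rightarrow> complex) \<Rightarrow> bool" where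
  "highest_weight_module M \<mu> \<longleftrightarrow> sl12_module M \<and>
     (\<exists>p. \<exists>v\<in>component M p. highest_weight_vector M \<mu> v \<and>
        (\<forall>N. sl12_submodule M N \<and> v \<in> N \<longrightarrow> N = carrier M))"

abbreviation finite_dimensional :: "'v supermodule \<Rightarrow> bool" where
  "finite_dimensional M \<equiv> vectorspace.fin_dim complex_ring M"

abbreviation module_dim :: "'v supermodule \<Rightarrow> nat" where
  "module_dim M \<equiv> vectorspace.dim complex_ring M"

text \<open>A highest weight module is cyclic over the enveloping algebra, hence isomorphic to a module
  whose vectors are cosets of a left ideal.  So every highest weight module has an isomorphic copy
  with carrier in \<^typ>\<open>uea set\<close>, and an irreducible one is determined by its highest weight up to
  isomorphism and reversal of parity.\<close>

definition P_plus :: "(sl12 \<Rightarrow> complex) set" where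
  "P_plus = {\<mu> \<in> weights. \<exists>L :: uea set supermodule.
     irreducible_module L \<and> highest_weight_module L \<mu> \<and> finite_dimensional L}"


section \<open>Generalized Kac modules\<close>

definition uea_coset :: "uea set \<Rightarrow> uea \<Rightarrow> uea set" where
  "uea_coset J u = {u + j | j. j \<in> J}"

definition uea_quotient :: "uea set \<Rightarrow> uea set supermodule" where
  "uea_quotient J = \<lparr>
     carrier = range (uea_coset J), mult = undefined, one = undefined,
     zero = J,
     add = (\<lambda>A B. {a + b | a b. a \<in> A \<and> b \<in> B}),
     smult = (\<lambda>c A. {uea_scalar c * a + j | a j. a \<in> A \<and> j \<in> J}),
     act = (\<lambda>x A. {uea_gen x * a + j | a j. a \<in> A \<and> j \<in> J}),
     component = (\<lambda>p. uea_coset J ` {u. uea_homogeneous p u}) \<rparr>"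

text \<open>On \<^const>\<open>P_plus\<close> the value of a weight at \<^const>\<open>H2\<close> is a natural number, and the exponent of
  \<^const>\<open>Y2\<close> is its successor.\<close>

definition kac_ideal :: "(sl12 \<Rightarrow> complex) \<Rightarrow> uea set" where
  "kac_ideal \<mu> = left_ideal hull
     ({uea_gen x | x. x \<in> n_plus} \<union>
      {uea_gen h - uea_scalar (\<mu> h) | h. h \<in> cartan} \<union>
      {uea_gen Y2 ^ (nat \<lfloor>Re (\<mu> H2)\<rfloor> + 1)})"

definition kac_module :: "(sl12 \<Rightarrow> complex) \<Rightarrow> uea set supermodule" where
  "kac_module \<mu> = uea_quotient (kac_ideal \<mu>)"

end

theory Submission
  imports Defs
begin

text \<open>
  Let \<open>v\<close> be a highest weight vector of weight \<open>\<mu>\<close>, put \<open>l = \<mu> H2\<close>, and write \<open>\<mu> H1 = l (1 + a)\<close>;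
  every \<open>\<mu>\<close> with \<open>l \<noteq> 0\<close> has this form, and so does the zero weight.  The negative root vectors are
  the odd \<open>X1\<close>, \<open>Y3\<close> and the even \<open>Y2 = [X1, Y3]\<close>, so the Verma module should have the basis
    \<open>A k = Y2\<^sup>k v\<close>, \<open>B k = X1 Y2\<^sup>k v\<close>, \<open>C k = Y3 Y2\<^sup>k v\<close>, \<open>D k = X1 Y3 Y2\<^sup>k v + a Y2\<^sup>k\<^sup>+\<^sup>1 v\<close>.
  The correction term in \<open>D k\<close> makes \<open>X2\<close> kill \<open>D 0\<close>.  Each of the four families is then a Verma
  module of the even subalgebra spanned by \<open>X2\<close>, \<open>H2\<close>, \<open>Y2\<close>, with highest weights \<open>l\<close>, \<open>l - 1\<close>,
  \<open>l - 1\<close>, \<open>l - 2\<close>.  All formulas for the action are polynomial in \<open>l\<close> and \<open>a\<close>, so the atypical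
  weights (\<open>\<mu> H1 = 0\<close> or \<open>\<mu> H1 = \<mu> H2\<close>) need no separate treatment.

  Let \<open>l = n\<close> be a natural number.  Imposing \<open>Y2\<^sup>n\<^sup>+\<^sup>1 v = 0\<close> and applying root vectors to this
  relation kills the tails \<open>k > n\<close>, \<open>k \<ge> n\<close>, \<open>k \<ge> n\<close>, \<open>k \<ge> n - 1\<close> of the four families
  (\<open>monomial_in_ideal\<close>), and the remaining \<open>(n + 1) + n + n + (n - 1) = 4 n\<close> vectors span the
  generalized Kac module (\<open>kac_spanning\<close>) if \<open>n \<ge> 1\<close>.  They are independent because the tails form
  a submodule of the Verma module.
  For this the Verma module is built from explicit operators on coefficient families: these satisfy
  the supercommutation relations (\<open>verma_op_superbracket\<close>), and they preserve the tails because at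
  the last index of each family the coefficient that would leave the tail vanishes (\<open>verma_op_tail\<close>).

  Such a weight, and likewise the zero weight (with \<open>n = 0\<close>), belongs to \<^const>\<open>P_plus\<close>: divide the
  enveloping algebra by the left ideal of all \<open>u\<close> such that no element of \<open>U u v\<close> has a nonzero
  coefficient at \<open>v\<close>.  The quotient is a quotient of the Kac module, hence finite dimensional, and it
  is irreducible because a polynomial in \<open>H2\<close> projects onto the highest weight line
  (\<open>irreducible_ideal_reaches_one\<close>).

  Conversely, in a finite-dimensional module an \<open>H2\<close>-eigenvector killed by \<open>X2\<close> has a natural number
  as eigenvalue (\<open>fin_dim_X2_highest_weight_nat\<close>), so \<open>\<mu> H2\<close> is one.  If \<open>\<mu> H2 = 0\<close>, the vector
  \<open>X1 v\<close> is killed by \<open>X2\<close> and has the eigenvalue \<open>- 1\<close>, so it is zero, and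
  \<open>\<mu> H1 v = X1 Y1 v + Y1 X1 v = 0\<close> leaves only the zero weight.\<close>


section \<open>Structure constants and the Verma module\<close>

lemma superbracket_entries:
  fixes x y :: sl12
  defines "A \<equiv> mat_of_sl12 x" and "B \<equiv> mat_of_sl12 y"
  defines "C \<equiv> mat_of_sl12 (superbracket x y)"
  shows "C $ 1 $ 1 = A$1$2 * B$2$1 + A$1$3 * B$3$1 + B$1$2 * A$2$1 + B$1$3 * A$3$1"
    "C $ 1 $ 2 = A$1$1 * B$1$2 + A$1$2 * B$2$2 + A$1$3 * B$3$2 - B$1$1 * A$1$2 - B$1$2 * A$2$2 - B$1$3 * A$3$2"
    "C $ 1 $ 3 = A$1$1 * B$1$3 + A$1$2 * B$2$3 + A$1$3 * B$3$3 - B$1$1 * A$1$3 - B$1$2 * A$2$3 - B$1$3 * A$3$3"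
    "C $ 2 $ 1 = A$2$1 * B$1$1 + A$2$2 * B$2$1 + A$2$3 * B$3$1 - B$2$1 * A$1$1 - B$2$2 * A$2$1 - B$2$3 * A$3$1"
    "C $ 3 $ 1 = A$3$1 * B$1$1 + A$3$2 * B$2$1 + A$3$3 * B$3$1 - B$3$1 * A$1$1 - B$3$2 * A$2$1 - B$3$3 * A$3$1"
    "C $ 2 $ 2 = A$2$1 * B$1$2 + A$2$2 * B$2$2 + A$2$3 * B$3$2 + B$2$1 * A$1$2 - B$2$2 * A$2$2 - B$2$3 * A$3$2"
    "C $ 2 $ 3 = A$2$1 * B$1$3 + A$2$2 * B$2$3 + A$2$3 * B$3$3 + B$2$1 * A$1$3 - B$2$2 * A$2$3 - B$2$3 * A$3$3"
    "C $ 3 $ 2 = A$3$1 * B$1$2 + A$3$2 * B$2$2 + A$3$3 * B$3$2 + B$3$1 * A$1$2 - B$3$2 * A$2$2 - B$3$3 * A$3$2"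
    "C $ 3 $ 3 = A$3$1 * B$1$3 + A$3$2 * B$2$3 + A$3$3 * B$3$3 + B$3$1 * A$1$3 - B$3$2 * A$2$3 - B$3$3 * A$3$3"
  unfolding A_def B_def C_def
  by (simp_all add: superbracket.rep_eq mat_superbracket_def mat_component_def mat_scale_def super_sign_def
      index_parity_def matrix_matrix_mult_def sum_3 algebra_simps)

lemma mat_of_basis:
  "mat_of_sl12 X1 $ i $ j = (if i = 1 \<and> j = 2 then 1 else 0)"
  "mat_of_sl12 X2 $ i $ j = (if i = 2 \<and> j = 3 then 1 else 0)"
  "mat_of_sl12 X3 $ i $ j = (if i = 1 \<and> j = 3 then 1 else 0)"
  "mat_of_sl12 Y1 $ i $ j = (if i = 2 \<and> j = 1 then 1 else 0)"
  "mat_of_sl12 Y2 $ i $ j = (if i = 3 \<and> j = 2 then 1 else 0)"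
  "mat_of_sl12 Y3 $ i $ j = (if i = 3 \<and> j = 1 then 1 else 0)"
  "mat_of_sl12 H1 $ i $ j = (if i = j \<and> i \<noteq> 3 then 1 else 0)"
  "mat_of_sl12 H2 $ i $ j = (if i = j \<and> i \<noteq> 1 then (if i = 2 then 1 else - 1) else 0)"
  using exhaust_3[of i] exhaust_3[of j]
  by (auto simp: X1.rep_eq X2.rep_eq X3.rep_eq Y1.rep_eq Y2.rep_eq Y3.rep_eq H1.rep_eq H2.rep_eq
      mat_unit_def transpose_def)

lemma mat_of_sl12_linear:
  "mat_of_sl12 (x + y) $ i $ j = mat_of_sl12 x $ i $ j + mat_of_sl12 y $ i $ j"
  "mat_of_sl12 (x - y) $ i $ j = mat_of_sl12 x $ i $ j - mat_of_sl12 y $ i $ j"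
  "mat_of_sl12 (- x) $ i $ j = - mat_of_sl12 x $ i $ j"
  "mat_of_sl12 0 $ i $ j = 0"
  "mat_of_sl12 (scale_sl12 c x) $ i $ j = c * mat_of_sl12 x $ i $ j"
  by (simp_all add: plus_sl12.rep_eq minus_sl12.rep_eq uminus_sl12.rep_eq zero_sl12.rep_eq
      scale_sl12.rep_eq mat_scale_def)

lemma mat_of_sl12_22: "mat_of_sl12 x $ 2 $ 2 = mat_of_sl12 x $ 1 $ 1 - mat_of_sl12 x $ 3 $ 3"
  using mat_of_sl12[of x] by (simp add: algebra_simps)

lemma sl12_eq_iff:
  "x = y \<longleftrightarrow> (\<forall>i j. mat_of_sl12 x $ i $ j = mat_of_sl12 y $ i $ j)"
  by (simp add: mat_of_sl12_inject[symmetric] vec_eq_iff)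

lemmas sl12_entries = sl12_eq_iff forall_3 superbracket_entries mat_of_sl12_linear mat_of_basis

lemma sl12_expansion:
  fixes x :: sl12
  defines "A \<equiv> mat_of_sl12 x"
  shows "x = scale_sl12 (A$1$2) X1 + scale_sl12 (A$2$3) X2 + scale_sl12 (A$1$3) X3
     + scale_sl12 (A$2$1) Y1 + scale_sl12 (A$3$2) Y2 + scale_sl12 (A$3$1) Y3
     + scale_sl12 (A$1$1) H1 + scale_sl12 (- A$3$3) H2"
  unfolding A_def by (simp add: sl12_entries mat_of_sl12_22)

lemma superbracket_basis:
  "superbracket X1 X1 = 0" "superbracket X3 X1 = 0" 
  "superbracket Y3 Y3 = 0" "superbracket Y1 Y3 = 0"
  "superbracket X1 Y1 = H1" "superbracket X3 Y3 = H1 - H2"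
  "superbracket X3 Y1 = X2" "superbracket X1 Y3 = Y2"
  "superbracket X1 Y2 = 0" "superbracket Y3 Y2 = 0"
  "superbracket X3 Y2 = X1" "superbracket Y1 Y2 = - Y3"
  "superbracket H1 Y2 = - Y2" "superbracket H2 Y2 = - Y2 - Y2" "superbracket H1 Y3 = - Y3"
  "superbracket X2 Y2 = H2" "superbracket H2 X1 = - X1"
  "superbracket X2 X1 = - X3"
  by (simp_all add: sl12_entries)

lemma sl12_homogeneous_iff:
  "x \<in> sl12_homogeneous p \<longleftrightarrow> (if p = 0
     then mat_of_sl12 x $ 1 $ 2 = 0 \<and> mat_of_sl12 x $ 1 $ 3 = 0
       \<and> mat_of_sl12 x $ 2 $ 1 = 0 \<and> mat_of_sl12 x $ 3 $ 1 = 0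
     else mat_of_sl12 x $ 1 $ 1 = 0 \<and> mat_of_sl12 x $ 2 $ 2 = 0 \<and> mat_of_sl12 x $ 3 $ 3 = 0
       \<and> mat_of_sl12 x $ 2 $ 3 = 0 \<and> mat_of_sl12 x $ 3 $ 2 = 0)"
  by (cases p) (auto simp: sl12_homogeneous_def index_parity_def forall_3)

lemma basis_homogeneous:
  "X1 \<in> sl12_homogeneous 1" "X3 \<in> sl12_homogeneous 1" "Y1 \<in> sl12_homogeneous 1" "Y3 \<in> sl12_homogeneous 1"
  "X2 \<in> sl12_homogeneous 0" "Y2 \<in> sl12_homogeneous 0" "H1 \<in> sl12_homogeneous 0" "H2 \<in> sl12_homogeneous 0"
  by (simp_all add: sl12_homogeneous_iff mat_of_basis)

lemma cartan_eq: "cartan = {scale_sl12 a H1 + scale_sl12 b H2 | a b. True}"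
  unfolding cartan_def sl12.span_insert sl12.span_empty
  by (force simp: algebra_simps)

lemma n_plus_eq: "n_plus = {scale_sl12 a Y1 + scale_sl12 b X2 + scale_sl12 c X3 | a b c. True}"
  unfolding n_plus_def sl12.span_insert sl12.span_empty
  by (force simp: algebra_simps)

text \<open>The indices \<open>VA k\<close>, \<open>VB k\<close>, \<open>VC k\<close>, \<open>VD k\<close> stand for the basis vectors \<open>Y2\<^sup>k v\<close>, \<open>X1 Y2\<^sup>k v\<close>,
  \<open>Y3 Y2\<^sup>k v\<close> and \<open>X1 Y3 Y2\<^sup>k v + a Y2\<^sup>k\<^sup>+\<^sup>1 v\<close> of the Verma module.\<close>

datatype verma_index = VA nat | VB nat | VC nat | VD nat

text \<open>A raising operator reads the coefficient one step below; below index 0 there is none.\<close>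

definition prev :: "(nat \<Rightarrow> complex) \<Rightarrow> nat \<Rightarrow> complex" where
  "prev g k = (case k of 0 \<Rightarrow> 0 | Suc j \<Rightarrow> g j)"

lemma prev_simps [simp]: "prev g 0 = 0" "prev g (Suc k) = g k"
  by (simp_all add: prev_def)

text \<open>The Verma module of highest weight \<open>H1 \<mapsto> l (1 + a)\<close>, \<open>H2 \<mapsto> l\<close> in coordinates.  A function \<open>f\<close> is a
  formal, possibly infinite linear combination of basis vectors.  Each coordinate of the result
  depends on finitely many coordinates of \<open>f\<close>, so the action extends to such combinations and no
  condition of finite support has to be carried along.  The summand with the matrix entry \<open>m i j\<close>
  is the transpose of the action of the root vector \<open>E i j\<close> on the basis vectors; an element of the
  Cartan subalgebra is \<open>m 1 1\<close> times \<open>H1\<close> minus \<open>m 3 3\<close> times \<open>H2\<close>.\<close>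

fun verma_op :: "complex \<Rightarrow> complex \<Rightarrow> sl12 \<Rightarrow> (verma_index \<Rightarrow> complex) \<Rightarrow> verma_index \<Rightarrow> complex" where
  "verma_op l a x f (VA k) = (let m = (\<lambda>i j. mat_of_sl12 x $ i $ j) in
     (m 1 1 * (l * (1 + a) - of_nat k) - m 3 3 * (l - 2 * of_nat k)) * f (VA k)
     - m 1 2 * a * prev (\<lambda>j. f (VC j)) k
     + m 2 3 * (of_nat k + 1) * (l - of_nat k) * f (VA (Suc k))
     + m 1 3 * a * (l - of_nat k) * f (VC k)
     + m 2 1 * (1 + a) * (l - of_nat k) * f (VB k)
     + m 3 2 * prev (\<lambda>j. f (VA j)) k
     + m 3 1 * (1 + a) * prev (\<lambda>j. f (VB j)) k)"
| "verma_op l a x f (VB k) = (let m = (\<lambda>i j. mat_of_sl12 x $ i $ j) in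
     (m 1 1 * (l * (1 + a) - of_nat k) - m 3 3 * (l - 2 * of_nat k - 1)) * f (VB k)
     + m 1 2 * (f (VA k) + a * prev (\<lambda>j. f (VD j)) k)
     + m 2 3 * (of_nat k + 1) * (l - of_nat k - 1) * f (VB (Suc k))
     + m 1 3 * ((of_nat k + 1) * f (VA (Suc k)) + a * (of_nat k + 1 - l) * f (VD k))
     + m 3 2 * prev (\<lambda>j. f (VB j)) k)"
| "verma_op l a x f (VC k) = (let m = (\<lambda>i j. mat_of_sl12 x $ i $ j) in
     (m 1 1 * (l * (1 + a) - of_nat k - 1) - m 3 3 * (l - 2 * of_nat k - 1)) * f (VC k)
     + m 2 3 * (of_nat k + 1) * (l - of_nat k - 1) * f (VC (Suc k))
     + m 2 1 * ((1 + a) * (l - of_nat k - 1) * f (VD k) - (of_nat k + 1) * f (VA (Suc k)))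
     + m 3 2 * prev (\<lambda>j. f (VC j)) k
     + m 3 1 * (f (VA k) + (1 + a) * prev (\<lambda>j. f (VD j)) k))"
| "verma_op l a x f (VD k) = (let m = (\<lambda>i j. mat_of_sl12 x $ i $ j) in
     (m 1 1 * (l * (1 + a) - of_nat k - 1) - m 3 3 * (l - 2 * of_nat k - 2)) * f (VD k)
     + m 1 2 * f (VC k)
     + m 2 3 * (of_nat k + 1) * (l - of_nat k - 2) * f (VD (Suc k))
     + m 1 3 * (of_nat k + 1) * f (VC (Suc k))
     + m 2 1 * (of_nat k + 1) * f (VB (Suc k))
     + m 3 2 * prev (\<lambda>j. f (VD j)) k
     - m 3 1 * f (VB k))"

text \<open>Both sides are polynomial identities in the matrix entries, in \<open>l\<close>, \<open>a\<close>, \<open>k\<close> and in the coordinates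
  of \<open>f\<close>.  A product of two operators reaches two steps down, so the indices 0 and 1 are separate
  cases.\<close>

lemma verma_op_superbracket:
  assumes "x \<in> sl12_homogeneous p" "y \<in> sl12_homogeneous q"
  shows "verma_op l a (superbracket x y) f i =
     verma_op l a x (verma_op l a y f) i - super_sign p q * verma_op l a y (verma_op l a x f) i"
proof -
  have *: "\<And>k. k = 0 \<or> k = Suc 0 \<or> (\<exists>j. k = Suc (Suc j))"
    by (metis not0_implies_Suc)
  show ?thesis
  proof (cases i)
    case (VA k)
    then show ?thesis using assms *[of k]
      by (cases p; cases q) (auto simp: sl12_homogeneous_iff superbracket_entries super_sign_def mat_of_sl12_22 algebra_simps)
  next
    case (VB k)
    then show ?thesis using assms *[of k]
      by (cases p; cases q) (auto simp: sl12_homogeneous_iff superbracket_entries super_sign_def mat_of_sl12_22 algebra_simps)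
  next
    case (VC k)
    then show ?thesis using assms *[of k]
      by (cases p; cases q) (auto simp: sl12_homogeneous_iff superbracket_entries super_sign_def mat_of_sl12_22 algebra_simps)
  next
    case (VD k)
    then show ?thesis using assms *[of k]
      by (cases p; cases q) (auto simp: sl12_homogeneous_iff superbracket_entries super_sign_def mat_of_sl12_22 algebra_simps)
  qed
qed


section \<open>The enveloping superalgebra and its action on the Verma module\<close>

lemma uea_relations_subset: "uea_relations \<subseteq> uea_ideal"
  unfolding uea_ideal_def by (rule hull_subset)

lemma uea_gen_add: "uea_gen (x + y) = uea_gen x + uea_gen y"
proof (transfer)
  fix x y :: sl12
  have "free_gen (x + y) - free_gen x - free_gen y \<in> uea_relations"
    by (auto simp: uea_relations_def)
  then show "free_gen (x + y) - (free_gen x + free_gen y) \<in> uea_ideal"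
    using uea_relations_subset by (auto simp: algebra_simps)
qed

lemma uea_gen_scale_eq_scalar_mult: "uea_gen (scale_sl12 c x) = uea_scalar c * uea_gen x"
proof (transfer)
  fix c and x :: sl12
  have "free_gen (scale_sl12 c x) - free_scalar c * free_gen x \<in> uea_relations"
    by (auto simp: uea_relations_def)
  then show "free_gen (scale_sl12 c x) - free_scalar c * free_gen x \<in> uea_ideal"
    using uea_relations_subset by auto
qed

lemma uea_gen_superbracket:
  assumes "x \<in> sl12_homogeneous p" "y \<in> sl12_homogeneous q"
  shows "uea_gen (superbracket x y)
     = uea_gen x * uea_gen y - uea_scalar (super_sign p q) * (uea_gen y * uea_gen x)"
  using assms
proof (transfer)
  fix x y :: sl12 and p q
  assume "x \<in> sl12_homogeneous p" "y \<in> sl12_homogeneous q"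
  then have "free_gen x * free_gen y - free_scalar (super_sign p q) * free_gen y * free_gen x
        - free_gen (superbracket x y) \<in> uea_relations"
    unfolding uea_relations_def by blast
  then have "- (free_gen x * free_gen y - free_scalar (super_sign p q) * free_gen y * free_gen x
        - free_gen (superbracket x y)) \<in> uea_ideal"
    using uea_relations_subset uea_ideal_uminus by blast
  then show "free_gen (superbracket x y) - (free_gen x * free_gen y
      - free_scalar (super_sign p q) * (free_gen y * free_gen x)) \<in> uea_ideal"
    by (simp add: algebra_simps)
qed

lemma uea_gen_zero [simp]: "uea_gen 0 = 0"
  using uea_gen_add[of 0 0] by simp

lemma uea_gen_uminus: "uea_gen (- x) = - uea_gen x"
  using uea_gen_add[of x "- x"] by (simp add: eq_neg_iff_add_eq_0 add.commute)

lemma uea_gen_diff: "uea_gen (x - y) = uea_gen x - uea_gen y"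
  using uea_gen_add[of x "- y"] by (simp add: uea_gen_uminus)

lemma uea_scalar_add: "uea_scalar (c + d) = uea_scalar c + uea_scalar d"
  by transfer (simp add: free_scalar_def single_add uea_ideal_zero)

lemma uea_scalar_mult: "uea_scalar (c * d) = uea_scalar c * uea_scalar d"
  by transfer (simp add: free_scalar_def mult_single uea_ideal_zero)

lemma uea_scalar_one [simp]: "uea_scalar 1 = 1"
  by transfer (simp add: free_scalar_def uea_ideal_zero)

lemma uea_scalar_zero [simp]: "uea_scalar 0 = 0"
  by transfer (simp add: free_scalar_def uea_ideal_zero)

lemma poly_mapping_additive_induct [case_names zero single add]:
  assumes "P 0" "\<And>k c. P (Poly_Mapping.single k c)" "\<And>p q. P p \<Longrightarrow> P q \<Longrightarrow> P (p + q)"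
  shows "P (p :: 'k \<Rightarrow>\<^sub>0 'c::comm_monoid_add)"
proof -
  have "P (\<Sum>k\<in>K. Poly_Mapping.single k (Poly_Mapping.lookup p k))" if "finite K" for K
    using that by (induction K) (auto intro: assms)
  then have "P (\<Sum>k\<in>Poly_Mapping.keys p. Poly_Mapping.single k (Poly_Mapping.lookup p k))"
    by simp
  also have "(\<Sum>k\<in>Poly_Mapping.keys p. Poly_Mapping.single k (Poly_Mapping.lookup p k)) = p"
    by (rule poly_mapping_eqI) (auto simp: lookup_sum lookup_single when_def in_keys_iff)
  finally show ?thesis .
qed

lemma uea_scalar_commute: "u * uea_scalar c = uea_scalar c * u"
proof transfer
  fix p :: free_algebra and c
  have "p * free_scalar c = free_scalar c * p"
    by (induction p rule: poly_mapping_additive_induct)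
      (simp_all add: free_scalar_def mult_single algebra_simps)
  then show "p * free_scalar c - free_scalar c * p \<in> uea_ideal"
    by (simp add: uea_ideal_zero)
qed

definition uea_scale :: "complex \<Rightarrow> uea \<Rightarrow> uea"  (infixr \<open>*\<^sub>U\<close> 75) where
  "c *\<^sub>U u = uea_scalar c * u"

global_interpretation uea: vector_space uea_scale
  by standard (simp_all add: uea_scale_def algebra_simps uea_scalar_add uea_scalar_mult)

lemma uea_scale_mult_left [simp]: "(c *\<^sub>U u) * v = c *\<^sub>U (u * v)"
  by (simp add: uea_scale_def mult.assoc)

lemma uea_scale_mult_right [simp]: "u * (c *\<^sub>U v) = c *\<^sub>U (u * v)"
proof -
  have "u * (uea_scalar c * v) = (u * uea_scalar c) * v" by (simp add: mult.assoc)
  then show ?thesis by (simp add: uea_scale_def uea_scalar_commute mult.assoc)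
qed

lemma uea_gen_scale: "uea_gen (scale_sl12 c x) = c *\<^sub>U uea_gen x"
  by (simp add: uea_gen_scale_eq_scalar_mult uea_scale_def)

text \<open>Every element of the enveloping algebra is a linear combination of products of generators.\<close>

lemma uea_induct [case_names one gen add scale]:
  assumes "P 1" "\<And>x u. P u \<Longrightarrow> P (uea_gen x * u)" "\<And>u v. P u \<Longrightarrow> P v \<Longrightarrow> P (u + v)"
    "\<And>c u. P u \<Longrightarrow> P (c *\<^sub>U u)"
  shows "P u"
proof -
  have word: "P (abs_uea (Poly_Mapping.single (Free_Word xs) 1))" for xs
  proof (induction xs)
    case Nil
    then show ?case using assms(1)
      by (metis one_uea_def single_one zero_free_word_def)
  next
    case (Cons x xs)
    have "Poly_Mapping.single (Free_Word (x # xs)) (1::complex)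
        = free_gen x * Poly_Mapping.single (Free_Word xs) 1"
      by (simp add: free_gen_def mult_single plus_free_word_def)
    then have "abs_uea (Poly_Mapping.single (Free_Word (x # xs)) 1)
        = uea_gen x * abs_uea (Poly_Mapping.single (Free_Word xs) 1)"
      by (simp add: times_uea.abs_eq uea_gen.abs_eq)
    then show ?case using assms(2)[OF Cons] by simp
  qed
  have "P (abs_uea p)" for p
  proof (induction p rule: poly_mapping_additive_induct)
    case zero
    have "abs_uea 0 = 0 *\<^sub>U 1" by (simp add: zero_uea_def)
    then show ?case using assms(4)[OF assms(1)] by metis
  next
    case (single w c)
    have "Poly_Mapping.single w c = free_scalar c * Poly_Mapping.single w 1"
      by (simp add: free_scalar_def mult_single)
    then have "abs_uea (Poly_Mapping.single w c) = c *\<^sub>U abs_uea (Poly_Mapping.single w 1)"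
      by (simp add: times_uea.abs_eq uea_scalar.abs_eq uea_scale_def)
    then show ?case using assms(4)[OF word[of "letters w"]] by simp
  next
    case (add p q)
    then show ?case using assms(3) by (metis plus_uea.abs_eq)
  qed
  then show ?thesis by (metis Quotient3_abs_rep[OF Quotient3_uea])
qed

lemma uea_bracket_odd:
  assumes "x \<in> sl12_homogeneous 1" "y \<in> sl12_homogeneous 1"
  shows "uea_gen x * uea_gen y = uea_gen (superbracket x y) - uea_gen y * uea_gen x"
  using uea_gen_superbracket[OF assms] 
  by (simp add: super_sign_def algebra_simps flip: uea_scale_def)

lemma uea_bracket_even:
  assumes "x \<in> sl12_homogeneous 0 \<or> y \<in> sl12_homogeneous 0"
     "x \<in> sl12_homogeneous p" "y \<in> sl12_homogeneous q"
  shows "uea_gen x * uea_gen y = uea_gen (superbracket x y) + uea_gen y * uea_gen x"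
proof (cases "x \<in> sl12_homogeneous 0")
  case True
  show ?thesis using uea_gen_superbracket[OF True assms(3)] 
    by (simp add: super_sign_def)
next
  case False
  then have y: "y \<in> sl12_homogeneous 0" using assms by auto
  show ?thesis using uea_gen_superbracket[OF assms(2) y] 
    by (simp add: super_sign_def)
qed

text \<open>The relations bring products of odd root vectors into the order \<open>X1\<close>, \<open>Y3\<close>, \<open>Y1\<close>, \<open>X3\<close>, with the
  positive ones last.  The square of \<open>X1\<close> or \<open>Y3\<close> equals its own negative, so it vanishes in
  characteristic 0.\<close>

lemma uea_odd_relations:
  "uea_gen X1 * uea_gen X1 = 0" "uea_gen Y3 * uea_gen Y3 = 0"
  "uea_gen X3 * uea_gen X1 = - (uea_gen X1 * uea_gen X3)"
  "uea_gen Y1 * uea_gen Y3 = - (uea_gen Y3 * uea_gen Y1)"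
  "uea_gen Y1 * uea_gen X1 = uea_gen H1 - uea_gen X1 * uea_gen Y1"
  "uea_gen X3 * uea_gen Y3 = uea_gen H1 - uea_gen H2 - uea_gen Y3 * uea_gen X3"
  "uea_gen X3 * uea_gen Y1 = uea_gen X2 - uea_gen Y1 * uea_gen X3"
  "uea_gen Y3 * uea_gen X1 = uea_gen Y2 - uea_gen X1 * uea_gen Y3"
proof -
  have *: "u = 0" if "u = - u" for u :: uea
  proof -
    have "2 *\<^sub>U u = u + u" by (metis one_add_one uea.scale_left_distrib uea.scale_one)
    also have "\<dots> = 0" using that by (metis add.right_inverse)
    finally show ?thesis by simp
  qed
  show "uea_gen X1 * uea_gen X1 = 0" "uea_gen Y3 * uea_gen Y3 = 0"
    using uea_bracket_odd[of X1 X1] uea_bracket_odd[of Y3 Y3] 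
    by (simp_all add: basis_homogeneous superbracket_basis *)
  show "uea_gen X3 * uea_gen X1 = - (uea_gen X1 * uea_gen X3)"
    "uea_gen Y1 * uea_gen Y3 = - (uea_gen Y3 * uea_gen Y1)"
    "uea_gen Y1 * uea_gen X1 = uea_gen H1 - uea_gen X1 * uea_gen Y1"
    "uea_gen X3 * uea_gen Y3 = uea_gen H1 - uea_gen H2 - uea_gen Y3 * uea_gen X3"
    "uea_gen X3 * uea_gen Y1 = uea_gen X2 - uea_gen Y1 * uea_gen X3"
    "uea_gen Y3 * uea_gen X1 = uea_gen Y2 - uea_gen X1 * uea_gen Y3"
    using uea_bracket_odd[of X3 X1] uea_bracket_odd[of Y1 Y3] uea_bracket_odd[of X1 Y1] uea_bracket_odd[of X3 Y3]
     uea_bracket_odd[of X3 Y1] uea_bracket_odd[of X1 Y3]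
    by (simp_all add: basis_homogeneous superbracket_basis uea_gen_diff algebra_simps)
qed

lemma uea_Y2_relations:
  "uea_gen X1 * uea_gen Y2 = uea_gen Y2 * uea_gen X1"
  "uea_gen Y3 * uea_gen Y2 = uea_gen Y2 * uea_gen Y3"
  "uea_gen X3 * uea_gen Y2 = uea_gen Y2 * uea_gen X3 + uea_gen X1"
  "uea_gen Y1 * uea_gen Y2 = uea_gen Y2 * uea_gen Y1 - uea_gen Y3"
  "uea_gen H1 * uea_gen Y2 = uea_gen Y2 * uea_gen H1 - uea_gen Y2"
  "uea_gen H2 * uea_gen Y2 = uea_gen Y2 * uea_gen H2 - 2 *\<^sub>U uea_gen Y2"
  "uea_gen H1 * uea_gen Y3 = uea_gen Y3 * uea_gen H1 - uea_gen Y3"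
proof -
  have two: "2 *\<^sub>U u = u + u" for u by (metis one_add_one uea.scale_left_distrib uea.scale_one)
  show "uea_gen X1 * uea_gen Y2 = uea_gen Y2 * uea_gen X1"
  "uea_gen Y3 * uea_gen Y2 = uea_gen Y2 * uea_gen Y3"
  "uea_gen X3 * uea_gen Y2 = uea_gen Y2 * uea_gen X3 + uea_gen X1"
  "uea_gen Y1 * uea_gen Y2 = uea_gen Y2 * uea_gen Y1 - uea_gen Y3"
  "uea_gen H1 * uea_gen Y2 = uea_gen Y2 * uea_gen H1 - uea_gen Y2"
  "uea_gen H2 * uea_gen Y2 = uea_gen Y2 * uea_gen H2 - 2 *\<^sub>U uea_gen Y2"
  "uea_gen H1 * uea_gen Y3 = uea_gen Y3 * uea_gen H1 - uea_gen Y3"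
    using uea_bracket_even[of X1 Y2 1 0] uea_bracket_even[of Y3 Y2 1 0] uea_bracket_even[of X3 Y2 1 0]
     uea_bracket_even[of Y1 Y2 1 0] uea_bracket_even[of H1 Y2 0 0] uea_bracket_even[of H2 Y2 0 0]
     uea_bracket_even[of H1 Y3 0 1]
    by (simp_all add: basis_homogeneous superbracket_basis uea_gen_diff uea_gen_uminus two algebra_simps)
qed

text \<open>The odd root vectors \<open>X1\<close>, \<open>Y3\<close>, \<open>X3\<close>, \<open>Y1\<close> generate the Lie superalgebra: the brackets
  \<open>[X1, Y3]\<close>, \<open>[X3, Y1]\<close>, \<open>[X1, Y1]\<close>, \<open>[X3, Y3]\<close> supply \<open>Y2\<close>, \<open>X2\<close>, \<open>H1\<close> and \<open>H1 - H2\<close>.\<close>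

lemma subspace_closed_under_odd_root_vectors:
  assumes W: "uea.subspace W"
    and gens: "\<And>w. w \<in> W \<Longrightarrow> uea_gen X1 * w \<in> W" "\<And>w. w \<in> W \<Longrightarrow> uea_gen Y3 * w \<in> W"
      "\<And>w. w \<in> W \<Longrightarrow> uea_gen X3 * w \<in> W" "\<And>w. w \<in> W \<Longrightarrow> uea_gen Y1 * w \<in> W"
    and w: "w \<in> W"
  shows "u * w \<in> W"
proof -
  note sub = uea.subspace_add[OF W] uea.subspace_diff[OF W] uea.subspace_neg[OF W] uea.subspace_scale[OF W]
  have Y2: "uea_gen Y2 * w \<in> W" if "w \<in> W" for w
  proof -
    have "uea_gen Y2 = uea_gen Y3 * uea_gen X1 + uea_gen X1 * uea_gen Y3"
      by (simp add: uea_odd_relations)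
    then show ?thesis using that by (simp add: distrib_right mult.assoc sub gens)
  qed
  have X2: "uea_gen X2 * w \<in> W" if "w \<in> W" for w
  proof -
    have "uea_gen X2 = uea_gen X3 * uea_gen Y1 + uea_gen Y1 * uea_gen X3"
      by (simp add: uea_odd_relations)
    then show ?thesis using that by (simp add: distrib_right mult.assoc sub gens)
  qed
  have H1: "uea_gen H1 * w \<in> W" if "w \<in> W" for w
  proof -
    have "uea_gen H1 = uea_gen Y1 * uea_gen X1 + uea_gen X1 * uea_gen Y1"
      by (simp add: uea_odd_relations)
    then show ?thesis using that by (simp add: distrib_right mult.assoc sub gens)
  qed
  have H2: "uea_gen H2 * w \<in> W" if "w \<in> W" for w
  proof -
    have "uea_gen H2 = uea_gen H1 - (uea_gen X3 * uea_gen Y3 + uea_gen Y3 * uea_gen X3)"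
      by (simp add: uea_odd_relations)
    then show ?thesis using that by (simp add: distrib_right left_diff_distrib mult.assoc sub gens H1)
  qed
  have gen: "uea_gen x * w \<in> W" if "w \<in> W" for x w
    by (subst sl12_expansion[of x])
      (simp add: that uea_gen_add uea_gen_scale uea_gen_diff distrib_right left_diff_distrib sub gens Y2 X2 H1 H2)
  show ?thesis
    by (induction u rule: uea_induct) (simp_all add: w gen mult.assoc distrib_right sub)
qed

lemma verma_op_linear:
  "verma_op l a x (\<lambda>i. c * f i + d * g i) i = c * verma_op l a x f i + d * verma_op l a x g i"
  by (cases i; rename_tac k; case_tac k) (simp_all add: algebra_simps)

lemma verma_op_add_left: "verma_op l a (x + y) f i = verma_op l a x f i + verma_op l a y f i"
  by (cases i) (simp_all add: mat_of_sl12_linear algebra_simps)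

lemma verma_op_scale_left: "verma_op l a (scale_sl12 c x) f i = c * verma_op l a x f i"
  by (cases i) (simp_all add: mat_of_sl12_linear algebra_simps)

definition word_act :: "complex \<Rightarrow> complex \<Rightarrow> sl12 free_word \<Rightarrow> (verma_index \<Rightarrow> complex) \<Rightarrow> verma_index \<Rightarrow> complex" where
  "word_act l a w = foldr (verma_op l a) (letters w)"

lemma word_act_plus: "word_act l a (v + w) f = word_act l a v (word_act l a w f)"
  by (simp add: word_act_def plus_free_word_def)

lemma word_act_zero [simp]: "word_act l a 0 f = f"
  by (simp add: word_act_def zero_free_word_def)

lemma word_act_linear:
  "word_act l a w (\<lambda>i. c * f i + d * g i) = (\<lambda>i. c * word_act l a w f i + d * word_act l a w g i)"
proof -
  have "foldr (verma_op l a) xs (\<lambda>i. c * f i + d * g i)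
      = (\<lambda>i. c * foldr (verma_op l a) xs f i + d * foldr (verma_op l a) xs g i)" for xs
    by (induction xs) (auto simp: verma_op_linear)
  then show ?thesis by (simp add: word_act_def)
qed

definition free_act :: "complex \<Rightarrow> complex \<Rightarrow> free_algebra \<Rightarrow> (verma_index \<Rightarrow> complex) \<Rightarrow> verma_index \<Rightarrow> complex" where
  "free_act l a p f i = (\<Sum>w\<in>Poly_Mapping.keys p. Poly_Mapping.lookup p w * word_act l a w f i)"

lemma free_act_add: "free_act l a (p + q) f i = free_act l a p f i + free_act l a q f i"
  unfolding free_act_def by (rule setsum_keys_plus_distrib) (simp_all add: distrib_right)

lemma free_act_zero [simp]: "free_act l a 0 f i = 0"
  by (simp add: free_act_def)

lemma free_act_single [simp]: "free_act l a (Poly_Mapping.single w c) f i = c * word_act l a w f i"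
  by (simp add: free_act_def)

lemma free_act_uminus: "free_act l a (- p) f i = - free_act l a p f i"
  using free_act_add[of l a p "- p" f i] by (simp add: eq_neg_iff_add_eq_0 add.commute)

lemma free_act_diff: "free_act l a (p - q) f i = free_act l a p f i - free_act l a q f i"
  using free_act_add[of l a p "- q" f i] by (simp add: free_act_uminus)

lemma free_act_linear:
  "free_act l a p (\<lambda>i. c * f i + d * g i) i = c * free_act l a p f i + d * free_act l a p g i"
  by (induction p rule: poly_mapping_additive_induct)
    (simp_all add: free_act_add word_act_linear algebra_simps)

lemma free_act_zero_vector: "free_act l a p (\<lambda>i. 0) i = 0"
  using free_act_linear[of l a p 0 "\<lambda>_. 0" 0 "\<lambda>_. 0" i] by simp

lemma free_act_mult: "free_act l a (p * q) f i = free_act l a p (free_act l a q f) i"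
proof (induction p arbitrary: i rule: poly_mapping_additive_induct)
  case (single v c)
  have "free_act l a (Poly_Mapping.single v c * q) f i = c * word_act l a v (free_act l a q f) i"
  proof (induction q arbitrary: i rule: poly_mapping_additive_induct)
    case zero
    then show ?case using word_act_linear[of l a v 0 f 0 f] by (simp add: free_act_def[abs_def])
  next
    case (single w d)
    have "word_act l a v (\<lambda>i. d * word_act l a w f i) i = d * word_act l a v (word_act l a w f) i"
      using word_act_linear[of l a v d "word_act l a w f" 0 f] by simp
    moreover have "free_act l a (Poly_Mapping.single w d) f = (\<lambda>i. d * word_act l a w f i)"
      by auto
    ultimately show ?case by (simp add: mult_single word_act_plus)
  next
    case (add p q)
    have "free_act l a (p + q) f = (\<lambda>i. 1 * free_act l a p f i + 1 * free_act l a q f i)"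
      by (auto simp: free_act_add)
    then show ?case
      by (simp only: distrib_left free_act_add add word_act_linear)
        (simp add: distrib_left)
  qed
  then show ?case by simp
qed (simp_all add: distrib_right free_act_add)

lemma free_act_gen [simp]: "free_act l a (free_gen x) f i = verma_op l a x f i"
  by (simp add: free_gen_def word_act_def)

lemma free_act_scalar [simp]: "free_act l a (free_scalar c) f i = c * f i"
  by (simp add: free_scalar_def)

text \<open>The elements that act as zero form a two-sided ideal, and it contains the defining relations
  because the operators satisfy them.\<close>

lemma free_act_uea_ideal:
  assumes "p \<in> uea_ideal"
  shows "free_act l a p f i = 0"
proof -
  let ?I = "{p. \<forall>f i. free_act l a p f i = 0}"
  have "two_sided_ideal ?I"
    unfolding two_sided_ideal_def
    using free_act_zero_vector[of l a]
    by (auto simp: free_act_add free_act_mult) (metis ext)+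
  moreover have "uea_relations \<subseteq> ?I"
    by (auto simp: uea_relations_def free_act_diff free_act_mult verma_op_add_left verma_op_scale_left
      verma_op_superbracket mult.assoc free_act_gen[abs_def])
  ultimately have "uea_ideal \<subseteq> ?I"
    unfolding uea_ideal_def by (rule hull_minimal[rotated])
  then show ?thesis using assms by auto
qed

lift_definition verma_act :: "complex \<Rightarrow> complex \<Rightarrow> uea \<Rightarrow> (verma_index \<Rightarrow> complex) \<Rightarrow> verma_index \<Rightarrow> complex"
  is free_act
proof (intro ext)
  fix l a :: complex and p q f i
  assume "p - q \<in> uea_ideal"
  then show "free_act l a p f i = free_act l a q f i"
    using free_act_uea_ideal[of "p - q" l a f i] by (simp add: free_act_diff)
qed

lemma verma_act_zero [simp]: "verma_act l a 0 f i = 0"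
  by transfer simp
lemma verma_act_one [simp]: "verma_act l a 1 f = f"
  by (transfer, rule ext) (simp flip: single_one)
lemma verma_act_add: "verma_act l a (u + v) f i = verma_act l a u f i + verma_act l a v f i"
  by transfer (rule free_act_add)
lemma verma_act_diff: "verma_act l a (u - v) f i = verma_act l a u f i - verma_act l a v f i"
  by transfer (rule free_act_diff)
lemma verma_act_mult: "verma_act l a (u * v) f = verma_act l a u (verma_act l a v f)"
  by (transfer, rule ext) (rule free_act_mult)
lemma verma_act_gen [simp]: "verma_act l a (uea_gen x) f = verma_op l a x f"
  by (transfer, rule ext) simp
lemma verma_act_scale [simp]: "verma_act l a (c *\<^sub>U u) f i = c * verma_act l a u f i"
  unfolding uea_scale_def by transfer (simp add: free_act_mult)

section \<open>Quotients by left ideals and their dimension\<close>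

lemma field_complex_ring: "field complex_ring"
proof -
  have "\<exists>y. x + y = 0" for x :: complex by (metis add.right_inverse)
  then have cring: "cring complex_ring"
    by (intro cringI abelian_groupI comm_monoidI) (auto simp: algebra_simps add_eq_0_iff2)
  have "\<exists>y. y * x = 1 \<and> x * y = 1" if "x \<noteq> 0" for x :: complex
    using that by (intro exI[of _ "inverse x"]) simp
  then show ?thesis
    by (intro cring.cring_fieldI[OF cring]) (auto simp: Units_def)
qed

lemma left_ideal_subspace:
  assumes "left_ideal J"
  shows "uea.subspace J"
  using assms unfolding left_ideal_def uea.subspace_def uea_scale_def by blast

lemma left_ideal_mult: "left_ideal J \<Longrightarrow> j \<in> J \<Longrightarrow> u * j \<in> J"
  unfolding left_ideal_def by blast

lemma uea_coset_eq_iff: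
  assumes "left_ideal J"
  shows "uea_coset J u = uea_coset J v \<longleftrightarrow> u - v \<in> J"
proof
  note sub = left_ideal_subspace[OF assms]
  assume "uea_coset J u = uea_coset J v"
  moreover have "u \<in> uea_coset J u"
    using uea.subspace_0[OF sub] by (force simp: uea_coset_def)
  ultimately show "u - v \<in> J" by (auto simp: uea_coset_def)
next
  note sub = left_ideal_subspace[OF assms]
  assume uv: "u - v \<in> J"
  have "uea_coset J u' \<subseteq> uea_coset J v'" if "u' - v' \<in> J" for u' v'
  proof
    fix w assume "w \<in> uea_coset J u'"
    then obtain j where "j \<in> J" "w = u' + j" by (auto simp: uea_coset_def)
    then have "w = v' + (u' - v' + j)" "u' - v' + j \<in> J"
      using uea.subspace_add[OF sub that] by auto
    then show "w \<in> uea_coset J v'" unfolding uea_coset_def by blast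
  qed
  moreover have "v - u \<in> J" using uea.subspace_neg[OF sub uv] by simp
  ultimately show "uea_coset J u = uea_coset J v" using uv by blast
qed

lemma uea_coset_zero: "left_ideal J \<Longrightarrow> uea_coset J 0 = J"
  by (auto simp: uea_coset_def)

lemma uea_quotient_zero: "left_ideal J \<Longrightarrow> \<zero>\<^bsub>uea_quotient J\<^esub> = uea_coset J 0"
  by (simp add: uea_quotient_def uea_coset_zero)

lemma uea_quotient_carrier: "carrier (uea_quotient J) = range (uea_coset J)"
  by (simp add: uea_quotient_def)

lemma uea_quotient_component: "component (uea_quotient J) p = uea_coset J ` {u. uea_homogeneous p u}"
  by (simp add: uea_quotient_def)

lemma uea_quotient_add:
  assumes "left_ideal J"
  shows "uea_coset J u \<oplus>\<^bsub>uea_quotient J\<^esub> uea_coset J v = uea_coset J (u + v)"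
proof -
  note sub = left_ideal_subspace[OF assms]
  have "{a + b | a b. a \<in> uea_coset J u \<and> b \<in> uea_coset J v} = uea_coset J (u + v)" (is "?L = ?R")
  proof
    show "?L \<subseteq> ?R"
    proof
      fix w assume "w \<in> ?L"
      then obtain i j where "i \<in> J" "j \<in> J" "w = (u + i) + (v + j)" by (auto simp: uea_coset_def)
      then have "w = (u + v) + (i + j)" "i + j \<in> J"
        using uea.subspace_add[OF sub] by (auto simp: algebra_simps)
      then show "w \<in> ?R" unfolding uea_coset_def by blast
    qed
    show "?R \<subseteq> ?L"
    proof
      fix w assume "w \<in> ?R"
      then obtain j where "j \<in> J" "w = (u + j) + (v + 0)" by (auto simp: uea_coset_def algebra_simps)
      then show "w \<in> ?L" using uea.subspace_0[OF sub] unfolding uea_coset_def by blast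
    qed
  qed
  then show ?thesis by (simp add: uea_quotient_def)
qed

lemma left_mult_coset:
  assumes "left_ideal J"
  shows "{w * a + j | a j. a \<in> uea_coset J u \<and> j \<in> J} = uea_coset J (w * u)" (is "?L = ?R")
proof
  note sub = left_ideal_subspace[OF assms]
  show "?L \<subseteq> ?R"
  proof
    fix x assume "x \<in> ?L"
    then obtain i j where "i \<in> J" "j \<in> J" "x = w * (u + i) + j" by (auto simp: uea_coset_def)
    then have "x = w * u + (w * i + j)" "w * i + j \<in> J"
      using uea.subspace_add[OF sub] left_ideal_mult[OF assms] by (auto simp: algebra_simps)
    then show "x \<in> ?R" unfolding uea_coset_def by blast
  qed
  show "?R \<subseteq> ?L"
  proof
    fix x assume "x \<in> ?R"
    then obtain j where "j \<in> J" "x = w * (u + 0) + j" by (auto simp: uea_coset_def)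
    then show "x \<in> ?L" using uea.subspace_0[OF sub] unfolding uea_coset_def by blast
  qed
qed

lemma uea_quotient_smult:
  assumes "left_ideal J"
  shows "c \<odot>\<^bsub>uea_quotient J\<^esub> uea_coset J u = uea_coset J (c *\<^sub>U u)"
  using left_mult_coset[OF assms, of "uea_scalar c" u] by (simp add: uea_quotient_def uea_scale_def)

lemma uea_quotient_act:
  assumes "left_ideal J"
  shows "act (uea_quotient J) x (uea_coset J u) = uea_coset J (uea_gen x * u)"
  using left_mult_coset[OF assms, of "uea_gen x" u] by (simp add: uea_quotient_def)

lemmas uea_quotient_simps = uea_quotient_carrier uea_quotient_add uea_quotient_smult uea_quotient_zero
  uea_quotient_act

lemma vectorspace_uea_quotient:
  assumes "left_ideal J"
  shows "vectorspace complex_ring (uea_quotient J)"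
proof (rule vs_criteria[OF field_complex_ring])
  have "\<exists>w. uea_coset J (v + w) = uea_coset J 0" for v
    by (rule exI[of _ "- v"]) simp
  then show "\<forall>v\<in>carrier (uea_quotient J). \<exists>neg_v\<in>carrier (uea_quotient J).
      v \<oplus>\<^bsub>uea_quotient J\<^esub> neg_v = \<zero>\<^bsub>uea_quotient J\<^esub>"
    by (simp add: uea_quotient_simps assms)
qed (auto simp: uea_quotient_simps assms algebra_simps uea.scale_left_distrib uea.scale_right_distrib)

lemma uea_quotient_finsum:
  assumes "left_ideal J" "finite S"
  shows "finsum (uea_quotient J) (\<lambda>i. uea_coset J (g i)) S = uea_coset J (\<Sum>i\<in>S. g i)"
proof -
  interpret vectorspace complex_ring "uea_quotient J" by (rule vectorspace_uea_quotient[OF assms(1)])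
  show ?thesis using assms(2)
    by (induction S) (auto simp: uea_quotient_simps assms(1) Pi_def)
qed

lemma uea_quotient_lincomb:
  assumes "left_ideal J" "finite S" "inj_on (\<lambda>i. uea_coset J (m i)) S"
  shows "module.lincomb (uea_quotient J) b ((\<lambda>i. uea_coset J (m i)) ` S)
     = uea_coset J (\<Sum>i\<in>S. b (uea_coset J (m i)) *\<^sub>U m i)"
proof -
  interpret vectorspace complex_ring "uea_quotient J" by (rule vectorspace_uea_quotient[OF assms(1)])
  have "lincomb b ((\<lambda>i. uea_coset J (m i)) ` S)
      = finsum (uea_quotient J) (\<lambda>i. b (uea_coset J (m i)) \<odot>\<^bsub>uea_quotient J\<^esub> uea_coset J (m i)) S"
    unfolding lincomb_def by (rule finsum_reindex[OF _ assms(3)]) (auto simp: uea_quotient_simps assms(1))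
  then show ?thesis
    by (simp add: uea_quotient_smult uea_quotient_finsum assms)
qed

lemma uea_quotient_span:
  assumes J: "left_ideal J" and S: "finite S"
    and span: "\<And>u. \<exists>c. u - (\<Sum>i\<in>S. c i *\<^sub>U m i) \<in> J"
  shows "LinearCombinations.module.span complex_ring (uea_quotient J) ((\<lambda>i. uea_coset J (m i)) ` S)
    = carrier (uea_quotient J)"
proof -
  interpret V: vectorspace complex_ring "uea_quotient J" by (rule vectorspace_uea_quotient[OF J])
  let ?B = "(\<lambda>i. uea_coset J (m i)) ` S"
  have B: "?B \<subseteq> carrier (uea_quotient J)" by (auto simp: uea_quotient_simps)
  have "carrier (uea_quotient J) \<subseteq> V.span ?B"
  proof
    fix X assume "X \<in> carrier (uea_quotient J)"
    then obtain u where u: "X = uea_coset J u" by (auto simp: uea_quotient_simps)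
    obtain c where "u - (\<Sum>i\<in>S. c i *\<^sub>U m i) \<in> J" using span by blast
    then have X: "X = uea_coset J (\<Sum>i\<in>S. c i *\<^sub>U m i)" using u uea_coset_eq_iff[OF J] by simp
    have sub: "submodule complex_ring (V.span ?B) (uea_quotient J)"
      by (rule V.span_is_submodule[OF B])
    have "uea_coset J (\<Sum>i\<in>T. c i *\<^sub>U m i) \<in> V.span ?B" if "finite T" "T \<subseteq> S" for T
      using that
    proof (induction T)
      case empty
      then show ?case
        using submodule.zero_closed[OF sub] by (simp add: uea_quotient_zero[OF J])
    next
      case (insert i T)
      then have "uea_coset J (m i) \<in> V.span ?B"
        using V.in_own_span[OF B] by auto
      then have "c i \<odot>\<^bsub>uea_quotient J\<^esub> uea_coset J (m i) \<in> V.span ?B"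
        using submodule.smult_closed[OF sub] by simp
      then have "c i \<odot>\<^bsub>uea_quotient J\<^esub> uea_coset J (m i) \<oplus>\<^bsub>uea_quotient J\<^esub> uea_coset J (\<Sum>i\<in>T. c i *\<^sub>U m i)
          \<in> V.span ?B"
        using insert submodule.m_closed[OF sub] by simp
      then show ?case using insert by (simp add: uea_quotient_simps J)
    qed
    from this[OF S order_refl] show "X \<in> V.span ?B" using X by simp
  qed
  then show ?thesis using V.span_is_subset2[OF B] by blast
qed

lemma uea_quotient_fin_dim:
  assumes J: "left_ideal J" and S: "finite S"
    and span: "\<And>u. \<exists>c. u - (\<Sum>i\<in>S. c i *\<^sub>U m i) \<in> J"
  shows "finite_dimensional (uea_quotient J)"
proof -
  interpret V: vectorspace complex_ring "uea_quotient J" by (rule vectorspace_uea_quotient[OF J])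
  show ?thesis
    unfolding V.fin_dim_def using S uea_quotient_span[OF assms]
    by (intro exI[of _ "(\<lambda>i. uea_coset J (m i)) ` S"]) (auto simp: uea_quotient_carrier)
qed

lemma uea_quotient_dim:
  assumes J: "left_ideal J" and S: "finite S"
    and span: "\<And>u. \<exists>c. u - (\<Sum>i\<in>S. c i *\<^sub>U m i) \<in> J"
    and indep: "\<And>c i. (\<Sum>i\<in>S. c i *\<^sub>U m i) \<in> J \<Longrightarrow> i \<in> S \<Longrightarrow> c i = 0"
  shows "module_dim (uea_quotient J) = card S"
proof -
  interpret V: vectorspace complex_ring "uea_quotient J" by (rule vectorspace_uea_quotient[OF J])
  let ?B = "(\<lambda>i. uea_coset J (m i)) ` S"
  have inj: "inj_on (\<lambda>i. uea_coset J (m i)) S"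
  proof (rule inj_onI, rule ccontr)
    fix i j assume ij: "i \<in> S" "j \<in> S" "uea_coset J (m i) = uea_coset J (m j)" "i \<noteq> j"
    let ?c = "\<lambda>k. if k = i then 1 else if k = j then -1 else (0::complex)"
    have "(\<Sum>k\<in>S. ?c k *\<^sub>U m k) = (\<Sum>k\<in>S. (if k = i then m i else 0) - (if k = j then m j else 0))"
      by (rule sum.cong) (use ij in auto)
    also have "\<dots> = m i - m j" using S ij by (simp add: sum_subtractf sum.delta)
    finally have "(\<Sum>k\<in>S. ?c k *\<^sub>U m k) \<in> J" using ij uea_coset_eq_iff[OF J] by simp
    from indep[OF this ij(1)] show False by simp
  qed
  have B: "?B \<subseteq> carrier (uea_quotient J)" "finite ?B" using S by (auto simp: uea_quotient_simps)
  have "V.lin_indpt ?B"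
  proof (rule V.finite_lin_indpt2[OF B(2,1)])
    fix b assume "V.lincomb b ?B = \<zero>\<^bsub>uea_quotient J\<^esub>"
    then have "(\<Sum>i\<in>S. b (uea_coset J (m i)) *\<^sub>U m i) \<in> J"
      using uea_coset_eq_iff[OF J, of _ 0] by (simp add: uea_quotient_lincomb[OF J S inj] uea_quotient_zero[OF J])
    from indep[OF this] show "\<forall>v\<in>?B. b v = \<zero>\<^bsub>complex_ring\<^esub>" by auto
  qed
  moreover have "V.gen_set ?B" by (rule uea_quotient_span[OF J S span])
  ultimately have "V.basis ?B" using B unfolding V.basis_def by blast
  then show ?thesis using V.dim_basis[OF B(2)] card_image[OF inj] by simp
qed


section \<open>Monomials modulo a highest weight ideal\<close>

abbreviation "Y2_pow k \<equiv> uea_gen Y2 ^ k"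

lemma commute_Y2_pow:
  "uea_gen X1 * Y2_pow k = Y2_pow k * uea_gen X1"
  "uea_gen Y3 * Y2_pow k = Y2_pow k * uea_gen Y3"
  by (rule power_commuting_commutes[symmetric], simp add: uea_Y2_relations)+

lemma uea_swap:
  "uea_gen X3 * (uea_gen X1 * u) = - (uea_gen X1 * (uea_gen X3 * u))"
  "uea_gen Y1 * (uea_gen Y3 * u) = - (uea_gen Y3 * (uea_gen Y1 * u))"
  "uea_gen Y1 * (uea_gen X1 * u) = uea_gen H1 * u - uea_gen X1 * (uea_gen Y1 * u)"
  "uea_gen X3 * (uea_gen Y3 * u) = uea_gen H1 * u - uea_gen H2 * u - uea_gen Y3 * (uea_gen X3 * u)"
  "uea_gen Y3 * (uea_gen X1 * u) = uea_gen Y2 * u - uea_gen X1 * (uea_gen Y3 * u)"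
  "uea_gen H1 * (uea_gen Y3 * u) = uea_gen Y3 * (uea_gen H1 * u) - uea_gen Y3 * u"
  "uea_gen Y2 * (uea_gen Y3 * u) = uea_gen Y3 * (uea_gen Y2 * u)"
  "uea_gen X1 * (uea_gen X1 * u) = 0" "uea_gen Y3 * (uea_gen Y3 * u) = 0"
  by (simp_all add: uea_odd_relations uea_Y2_relations left_diff_distrib flip: mult.assoc)

lemma uea_scale_two:
  "2 *\<^sub>U u = u + u" "(2 * c) *\<^sub>U u = c *\<^sub>U u + c *\<^sub>U u" "(c * 2) *\<^sub>U u = c *\<^sub>U u + c *\<^sub>U u"
  using uea.scale_left_distrib[of 1 1 u] uea.scale_left_distrib[of c c u]
  by (simp_all add: mult.commute)

text \<open>\<open>X1\<close> commutes with \<open>Y2\<close>, so \<open>[X3, Y2] = X1\<close> gives \<open>[X3, Y2\<^sup>k] = k X1 Y2\<^sup>k\<^sup>-\<^sup>1\<close> by the Leibniz rule;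
  likewise \<open>[Y1, Y2] = - Y3\<close> in the next lemma.  For \<open>k = 0\<close> the truncated exponent does no harm,
  as its coefficient is 0.\<close>

lemma X3_Y2_pow: "uea_gen X3 * Y2_pow k = Y2_pow k * uea_gen X3 + of_nat k *\<^sub>U (uea_gen X1 * Y2_pow (k - 1))"
proof (induction k)
  case (Suc k)
  have "uea_gen X3 * Y2_pow (Suc k) = uea_gen Y2 * (uea_gen X3 * Y2_pow k) + uea_gen X1 * Y2_pow k"
    by (simp add: uea_Y2_relations distrib_right flip: mult.assoc)
  also have "uea_gen Y2 * (uea_gen X3 * Y2_pow k) = 
      Y2_pow (Suc k) * uea_gen X3 + of_nat k *\<^sub>U (uea_gen X1 * (uea_gen Y2 * Y2_pow (k - 1)))"
    unfolding Suc by (simp add: distrib_left uea_Y2_relations flip: mult.assoc)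
  also have "of_nat k *\<^sub>U (uea_gen X1 * (uea_gen Y2 * Y2_pow (k - 1))) = of_nat k *\<^sub>U (uea_gen X1 * Y2_pow k)"
    by (cases k) simp_all
  finally show ?case by (simp add: uea.scale_left_distrib)
qed simp

lemma Y1_Y2_pow: "uea_gen Y1 * Y2_pow k = Y2_pow k * uea_gen Y1 - of_nat k *\<^sub>U (uea_gen Y3 * Y2_pow (k - 1))"
proof (induction k)
  case (Suc k)
  have "uea_gen Y1 * Y2_pow (Suc k) = uea_gen Y2 * (uea_gen Y1 * Y2_pow k) - uea_gen Y3 * Y2_pow k"
    by (simp add: uea_Y2_relations left_diff_distrib flip: mult.assoc)
  also have "uea_gen Y2 * (uea_gen Y1 * Y2_pow k) = 
      Y2_pow (Suc k) * uea_gen Y1 - of_nat k *\<^sub>U (uea_gen Y3 * (uea_gen Y2 * Y2_pow (k - 1)))"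
    unfolding Suc by (simp add: right_diff_distrib uea_Y2_relations flip: mult.assoc)
  also have "of_nat k *\<^sub>U (uea_gen Y3 * (uea_gen Y2 * Y2_pow (k - 1))) = of_nat k *\<^sub>U (uea_gen Y3 * Y2_pow k)"
    by (cases k) simp_all
  finally show ?case by (simp add: uea.scale_left_distrib)
qed simp

lemma H1_Y2_pow: "uea_gen H1 * Y2_pow k = Y2_pow k * uea_gen H1 - of_nat k *\<^sub>U Y2_pow k"
proof (induction k)
  case (Suc k)
  have "uea_gen H1 * Y2_pow (Suc k) = uea_gen Y2 * (uea_gen H1 * Y2_pow k) - uea_gen Y2 * Y2_pow k"
    by (simp add: uea_Y2_relations left_diff_distrib flip: mult.assoc)
  then show ?case
    unfolding Suc by (simp add: right_diff_distrib uea.scale_left_distrib mult.assoc)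
qed simp

lemma H2_Y2_pow: "uea_gen H2 * Y2_pow k = Y2_pow k * uea_gen H2 - (2 * of_nat k) *\<^sub>U Y2_pow k"
proof (induction k)
  case (Suc k)
  have "uea_gen H2 * Y2_pow (Suc k) = uea_gen Y2 * (uea_gen H2 * Y2_pow k) - 2 *\<^sub>U (uea_gen Y2 * Y2_pow k)"
    by (simp add: uea_Y2_relations left_diff_distrib flip: mult.assoc)
  then show ?case
    unfolding Suc by (simp add: right_diff_distrib uea.scale_left_distrib mult.assoc distrib_left)
qed simp

text \<open>The elements of the enveloping algebra that produce the basis vectors from \<open>v\<close>.\<close>

fun verma_monomial :: "complex \<Rightarrow> verma_index \<Rightarrow> uea" where
  "verma_monomial a (VA k) = Y2_pow k"
| "verma_monomial a (VB k) = uea_gen X1 * Y2_pow k"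
| "verma_monomial a (VC k) = uea_gen Y3 * Y2_pow k"
| "verma_monomial a (VD k) = uea_gen X1 * (uea_gen Y3 * Y2_pow k) + a *\<^sub>U Y2_pow (Suc k)"

lemma Y2_pow_monomial:
  "Y2_pow j * verma_monomial a (VA k) = verma_monomial a (VA (j + k))"
  "Y2_pow j * verma_monomial a (VB k) = verma_monomial a (VB (j + k))"
  "Y2_pow j * verma_monomial a (VC k) = verma_monomial a (VC (j + k))"
  by (simp_all add: power_add mult.assoc[symmetric] flip: commute_Y2_pow)

lemma X1_monomial:
  "uea_gen X1 * verma_monomial a (VA k) = verma_monomial a (VB k)"
  "uea_gen X1 * verma_monomial a (VB k) = 0"
  "uea_gen X1 * verma_monomial a (VC k) = verma_monomial a (VD k) - a *\<^sub>U verma_monomial a (VA (Suc k))"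
  "uea_gen X1 * verma_monomial a (VD k) = a *\<^sub>U verma_monomial a (VB (Suc k))"
  by (simp_all add: distrib_left uea_swap)

lemma Y3_monomial:
  "uea_gen Y3 * verma_monomial a (VA k) = verma_monomial a (VC k)"
  "uea_gen Y3 * verma_monomial a (VB k) = (1 + a) *\<^sub>U verma_monomial a (VA (Suc k)) - verma_monomial a (VD k)"
  "uea_gen Y3 * verma_monomial a (VC k) = 0"
  "uea_gen Y3 * verma_monomial a (VD k) = (1 + a) *\<^sub>U verma_monomial a (VC (Suc k))"
  by (simp_all add: uea.scale_left_distrib uea_swap distrib_left)

text \<open>Modulo \<open>J\<close> the class of 1 is a vector of the weight in question killed by \<open>Y1\<close> and \<open>X3\<close>, hence also
  by \<open>X2 = [X3, Y1]\<close>.\<close>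

locale hw_ideal =
  fixes J :: "uea set" and l a :: complex
  assumes left_ideal: "left_ideal J"
    and Y1: "uea_gen Y1 \<in> J" and X3: "uea_gen X3 \<in> J"
    and H1: "uea_gen H1 - uea_scalar (l * (1 + a)) \<in> J" and H2: "uea_gen H2 - uea_scalar l \<in> J"
begin

abbreviation "m \<equiv> verma_monomial a"

definition cong :: "uea \<Rightarrow> uea \<Rightarrow> bool"  (infix \<open>\<simeq>\<close> 50) where
  "u \<simeq> v \<longleftrightarrow> u - v \<in> J"

lemma subspace: "uea.subspace J" by (rule left_ideal_subspace[OF left_ideal])

lemma cong_refl [simp]: "u \<simeq> u"
  using uea.subspace_0[OF subspace] by (simp add: cong_def)

lemma cong_trans [trans]: "u \<simeq> v \<Longrightarrow> v \<simeq> w \<Longrightarrow> u \<simeq> w"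
  unfolding cong_def using uea.subspace_add[OF subspace] by fastforce

lemma cong_sym: "u \<simeq> v \<Longrightarrow> v \<simeq> u"
  unfolding cong_def using uea.subspace_neg[OF subspace] by fastforce

lemma cong_mult: "u \<simeq> v \<Longrightarrow> w * u \<simeq> w * v"
  unfolding cong_def using left_ideal_mult[OF left_ideal] by (metis right_diff_distrib)

lemma cong_add: "u \<simeq> v \<Longrightarrow> u' \<simeq> v' \<Longrightarrow> u + u' \<simeq> v + v'"
  unfolding cong_def using uea.subspace_add[OF subspace] by (metis add_diff_add)

lemma cong_diff: "u \<simeq> v \<Longrightarrow> u' \<simeq> v' \<Longrightarrow> u - u' \<simeq> v - v'"
  unfolding cong_def using uea.subspace_diff[OF subspace, of "u - v" "u' - v'"]
  by (simp add: algebra_simps)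

lemma cong_scale: "u \<simeq> v \<Longrightarrow> c *\<^sub>U u \<simeq> c *\<^sub>U v"
  unfolding cong_def using uea.subspace_scale[OF subspace] by (metis uea.scale_right_diff_distrib)

lemma cong_0_iff: "u \<simeq> 0 \<longleftrightarrow> u \<in> J"
  by (simp add: cong_def)

lemma H1_cong: "uea_gen H1 * Y2_pow k \<simeq> (l * (1 + a) - of_nat k) *\<^sub>U Y2_pow k"
proof -
  have "Y2_pow k * uea_gen H1 \<simeq> Y2_pow k * uea_scalar (l * (1 + a))"
    by (rule cong_mult) (simp add: cong_def H1)
  then have "Y2_pow k * uea_gen H1 \<simeq> (l * (1 + a)) *\<^sub>U Y2_pow k"
    by (simp add: uea_scalar_commute uea_scale_def)
  from cong_diff[OF this cong_refl] show ?thesis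
    unfolding H1_Y2_pow uea.scale_left_diff_distrib .
qed

lemma H2_cong: "uea_gen H2 * Y2_pow k \<simeq> (l - 2 * of_nat k) *\<^sub>U Y2_pow k"
proof -
  have "Y2_pow k * uea_gen H2 \<simeq> Y2_pow k * uea_scalar l"
    by (rule cong_mult) (simp add: cong_def H2)
  then have "Y2_pow k * uea_gen H2 \<simeq> l *\<^sub>U Y2_pow k"
    by (simp add: uea_scalar_commute uea_scale_def)
  from cong_diff[OF this cong_refl] show ?thesis
    unfolding H2_Y2_pow uea.scale_left_diff_distrib .
qed

lemma X3_VA: "uea_gen X3 * m (VA k) \<simeq> of_nat k *\<^sub>U m (VB (k - 1))"
proof -
  have "Y2_pow k * uea_gen X3 \<simeq> 0"
    by (simp add: cong_0_iff X3 left_ideal left_ideal_mult)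
  from cong_add[OF this cong_refl] show ?thesis by (simp add: X3_Y2_pow)
qed

lemma Y1_VA: "uea_gen Y1 * m (VA k) \<simeq> - (of_nat k *\<^sub>U m (VC (k - 1)))"
proof -
  have "Y2_pow k * uea_gen Y1 \<simeq> 0"
    by (simp add: cong_0_iff Y1 left_ideal left_ideal_mult)
  from cong_diff[OF this cong_refl] show ?thesis by (simp add: Y1_Y2_pow)
qed

text \<open>To apply \<open>X3\<close> or \<open>Y1\<close> to a monomial with odd factors, move it to the right past the first of them.
  Their superbracket is zero or a Cartan element, which acts on a power of \<open>Y2\<close> by a scalar, and what
  remains is a case treated before.  The resulting coefficients are those of \<^const>\<open>verma_op\<close>.\<close>

lemma X3_VB: "uea_gen X3 * m (VB k) \<simeq> 0"
proof -
  have "uea_gen X3 * m (VB k) = - (uea_gen X1 * (uea_gen X3 * m (VA k)))"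
    by (simp add: uea_swap)
  also have "\<dots> = 0 - uea_gen X1 * (uea_gen X3 * m (VA k))" by simp
  also have "\<dots> \<simeq> 0 - uea_gen X1 * (of_nat k *\<^sub>U m (VB (k - 1)))"
    by (intro cong_diff cong_refl cong_mult X3_VA)
  also have "\<dots> = 0" by (simp only: uea_scale_mult_right X1_monomial) simp
  finally show ?thesis .
qed

lemma X3_VC: "uea_gen X3 * m (VC k) \<simeq> (a * (l - of_nat k)) *\<^sub>U m (VA k) + of_nat k *\<^sub>U m (VD (k - 1))"
proof -
  have "uea_gen X3 * m (VC k) = uea_gen H1 * Y2_pow k - uea_gen H2 * Y2_pow k - uea_gen Y3 * (uea_gen X3 * m (VA k))"
    by (simp add: uea_swap)
  also have "\<dots> \<simeq> (l * (1 + a) - of_nat k) *\<^sub>U Y2_pow k - (l - 2 * of_nat k) *\<^sub>U Y2_pow k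
      - uea_gen Y3 * (of_nat k *\<^sub>U m (VB (k - 1)))"
    by (intro cong_diff H1_cong H2_cong cong_mult X3_VA)
  also have "\<dots> = (a * (l - of_nat k)) *\<^sub>U m (VA k) + of_nat k *\<^sub>U m (VD (k - 1))"
    unfolding uea_scale_mult_right Y3_monomial 
    by (cases k) (simp_all add: uea.scale_right_diff_distrib uea.scale_right_distrib uea.scale_left_distrib uea.scale_left_diff_distrib uea_scale_two algebra_simps del: verma_monomial.simps(4))
  finally show ?thesis .
qed

lemma X3_VD: "uea_gen X3 * m (VD k) \<simeq> (a * (of_nat k + 1 - l)) *\<^sub>U m (VB k)"
proof -
  have "uea_gen X3 * m (VD k) = a *\<^sub>U (uea_gen X3 * m (VA (Suc k))) - uea_gen X1 * (uea_gen X3 * m (VC k))"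
    by (simp add: uea_swap distrib_left)
  also have "\<dots> \<simeq> a *\<^sub>U (of_nat (Suc k) *\<^sub>U m (VB (Suc k - 1)))
     - uea_gen X1 * ((a * (l - of_nat k)) *\<^sub>U m (VA k) + of_nat k *\<^sub>U m (VD (k - 1)))"
    by (intro cong_diff cong_scale cong_mult X3_VA X3_VC)
  also have "\<dots> = (a * (of_nat k + 1 - l)) *\<^sub>U m (VB k)"
    unfolding uea_scale_mult_right X1_monomial distrib_left
    by (cases k) (simp_all add: uea.scale_right_diff_distrib uea.scale_right_distrib uea.scale_left_distrib uea.scale_left_diff_distrib uea_scale_two algebra_simps)
  finally show ?thesis .
qed

lemma Y1_VB: "uea_gen Y1 * m (VB k) \<simeq> ((1 + a) * (l - of_nat k)) *\<^sub>U m (VA k) + of_nat k *\<^sub>U m (VD (k - 1))"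
proof -
  have "uea_gen Y1 * m (VB k) = uea_gen H1 * Y2_pow k - uea_gen X1 * (uea_gen Y1 * m (VA k))"
    by (simp add: uea_swap)
  also have "\<dots> \<simeq> (l * (1 + a) - of_nat k) *\<^sub>U Y2_pow k - uea_gen X1 * - (of_nat k *\<^sub>U m (VC (k - 1)))"
    by (intro cong_diff H1_cong cong_mult Y1_VA)
  also have "\<dots> = ((1 + a) * (l - of_nat k)) *\<^sub>U m (VA k) + of_nat k *\<^sub>U m (VD (k - 1))"
    unfolding uea_scale_mult_right X1_monomial mult_minus_right
    by (cases k) (simp_all add: uea.scale_right_diff_distrib uea.scale_right_distrib uea.scale_left_distrib uea.scale_left_diff_distrib uea_scale_two algebra_simps del: verma_monomial.simps(4))
  finally show ?thesis .
qed

lemma Y1_VC: "uea_gen Y1 * m (VC k) \<simeq> 0"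
proof -
  have "uea_gen Y1 * m (VC k) = 0 - uea_gen Y3 * (uea_gen Y1 * m (VA k))"
    by (simp add: uea_swap)
  also have "\<dots> \<simeq> 0 - uea_gen Y3 * - (of_nat k *\<^sub>U m (VC (k - 1)))"
    by (intro cong_diff cong_refl cong_mult Y1_VA)
  also have "\<dots> = 0" by (simp only: uea_scale_mult_right mult_minus_right Y3_monomial) simp
  finally show ?thesis .
qed

lemma Y1_VD: "uea_gen Y1 * m (VD k) \<simeq> ((1 + a) * (l - of_nat k - 1)) *\<^sub>U m (VC k)"
proof -
  have "uea_gen Y1 * m (VD k) = uea_gen Y3 * (uea_gen H1 * Y2_pow k) - m (VC k) - uea_gen X1 * (uea_gen Y1 * m (VC k))
      + a *\<^sub>U (uea_gen Y1 * m (VA (Suc k)))"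
    by (simp add: uea_swap distrib_left)
  also have "\<dots> \<simeq> uea_gen Y3 * ((l * (1 + a) - of_nat k) *\<^sub>U Y2_pow k) - m (VC k) - uea_gen X1 * 0
      + a *\<^sub>U - (of_nat (Suc k) *\<^sub>U m (VC (Suc k - 1)))"
    by (intro cong_diff cong_add cong_scale H1_cong cong_mult Y1_VA Y1_VC cong_refl)
  also have "\<dots> = ((1 + a) * (l - of_nat k - 1)) *\<^sub>U m (VC k)"
    by (simp add: uea.scale_right_diff_distrib uea.scale_right_distrib uea.scale_left_distrib uea.scale_left_diff_distrib uea_scale_two algebra_simps)
  finally show ?thesis .
qed

end

text \<open>For \<open>n \<ge> 1\<close> these are the indices of the \<open>4 n\<close> basis vectors of the generalized Kac module.  For \<open>n = 0\<close>
  the truncated subtraction leaves just \<open>VA 0\<close>, the index of the highest weight vector.\<close>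

definition kac_indices :: "nat \<Rightarrow> verma_index set" where
  "kac_indices n = VA ` {..n} \<union> VB ` {..<n} \<union> VC ` {..<n} \<union> VD ` {..<n - 1}"

lemma finite_kac_indices [simp]: "finite (kac_indices n)"
  by (simp add: kac_indices_def)

lemma card_kac_indices:
  assumes "n \<ge> 1"
  shows "card (kac_indices n) = 4 * n"
proof -
  have disj: "(VA ` {..n} \<union> VB ` {..<n} \<union> VC ` {..<n}) \<inter> VD ` {..<n - 1} = {}"
    "(VA ` {..n} \<union> VB ` {..<n}) \<inter> VC ` {..<n} = {}" "VA ` {..n} \<inter> VB ` {..<n} = {}"
    by auto
  have "card (kac_indices n) = card (VA ` {..n}) + card (VB ` {..<n}) + card (VC ` {..<n}) + card (VD ` {..<n - 1})"
    unfolding kac_indices_def by (simp add: card_Un_disjoint disj del: One_nat_def)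
  also have "\<dots> = 4 * n" using assms by (simp add: card_image inj_on_def)
  finally show ?thesis .
qed

context hw_ideal begin

text \<open>Applying \<open>X3\<close> to \<open>Y2\<^sup>n\<^sup>+\<^sup>1\<close> gives \<open>(n + 1) X1 Y2\<^sup>n\<close>, and \<open>Y1\<close> gives \<open>- (n + 1) Y3 Y2\<^sup>n\<close>.  Applying \<open>X3\<close> to
  \<open>Y3 Y2\<^sup>n\<close> gives \<open>n\<close> times the monomial \<open>VD (n - 1)\<close>, because the coefficient \<open>a (l - n)\<close> of \<open>Y2\<^sup>n\<close> is
  zero.  Multiplication by powers of \<open>Y2\<close> or by \<open>X1\<close> yields the larger indices.\<close>

lemma monomial_in_ideal:
  assumes n: "l = of_nat n" "Y2_pow (n + 1) \<in> J" and i: "i \<notin> kac_indices n"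
  shows "m i \<in> J"
proof -
  note mult = left_ideal_mult[OF left_ideal]
  note sub = uea.subspace_add[OF subspace] uea.subspace_diff[OF subspace] uea.subspace_neg[OF subspace]
    uea.subspace_scale[OF subspace]
  have cancel: "u \<in> J" if "c *\<^sub>U u \<in> J" "c \<noteq> 0" for c u
    using uea.subspace_scale[OF subspace that(1), of "inverse c"] that(2) by simp
  have A: "m (VA k) \<in> J" if "k > n" for k
    using mult[OF n(2), of "Y2_pow (k - (n + 1))"] that Y2_pow_monomial(1)[of "k - (n + 1)" a "n + 1"] by simp
  have B: "m (VB k) \<in> J" if "k \<ge> n" for k
  proof -
    have "of_nat (n + 1) *\<^sub>U m (VB n) \<simeq> uea_gen X3 * m (VA (n + 1))"
      using cong_sym[OF X3_VA[of "n + 1"]] by simp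
    also have "\<dots> \<simeq> 0" unfolding cong_0_iff by (intro mult A) simp
    finally have "m (VB n) \<in> J" unfolding cong_0_iff by (rule cancel) (metis of_nat_eq_0_iff Suc_eq_plus1 nat.distinct(1))
    from mult[OF this, of "Y2_pow (k - n)"] show ?thesis
      unfolding Y2_pow_monomial using that by simp
  qed
  have C: "m (VC k) \<in> J" if "k \<ge> n" for k
  proof -
    have "- (of_nat (n + 1) *\<^sub>U m (VC n)) \<simeq> uea_gen Y1 * m (VA (n + 1))"
      using cong_sym[OF Y1_VA[of "n + 1"]] by simp
    also have "\<dots> \<simeq> 0" unfolding cong_0_iff by (intro mult A) simp
    finally have "(- of_nat (n + 1)) *\<^sub>U m (VC n) \<in> J" unfolding cong_0_iff uea.scale_minus_left .
    then have "m (VC n) \<in> J" by (rule cancel) (metis neg_equal_0_iff_equal of_nat_eq_0_iff Suc_eq_plus1 nat.distinct(1))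
    from mult[OF this, of "Y2_pow (k - n)"] show ?thesis
      unfolding Y2_pow_monomial using that by simp
  qed
  \<comment> \<open>For \<open>k \<ge> n\<close> both terms of the monomial lie in \<open>J\<close>; only \<open>k = n - 1\<close> needs the division by \<open>n\<close>.\<close>
  have D: "m (VD k) \<in> J" if "k \<ge> n - 1" for k
  proof (cases "k \<ge> n")
    case True
    have "m (VD k) = uea_gen X1 * m (VC k) + a *\<^sub>U m (VA (Suc k))"
      unfolding X1_monomial by simp
    then show ?thesis using mult[OF C[OF True]] A[of "Suc k"] True by (auto intro: sub)
  next
    case False
    then have k: "k = n - 1" "n \<noteq> 0" using that by auto
    have "of_nat n *\<^sub>U m (VD (n - 1)) \<simeq> uea_gen X3 * m (VC n)"
      using cong_sym[OF X3_VC[of n]] n(1) by simp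
    also have "\<dots> \<simeq> 0" unfolding cong_0_iff by (intro mult C) simp
    finally have "m (VD (n - 1)) \<in> J" unfolding cong_0_iff by (rule cancel) (use k in simp)
    then show ?thesis using k by simp
  qed
  show ?thesis
    using i A B C D by (cases i) (auto simp: kac_indices_def image_iff not_less not_le simp del: verma_monomial.simps)
qed

text \<open>The span of the listed monomials plus \<open>J\<close> contains all monomials, hence is closed under the four
  odd root vectors, hence under the enveloping algebra; and it contains \<open>1 = Y2\<^sup>0\<close>.\<close>

lemma kac_spanning:
  assumes n: "l = of_nat n" "Y2_pow (n + 1) \<in> J"
  shows "\<exists>c. u - (\<Sum>i\<in>kac_indices n. c i *\<^sub>U m i) \<in> J"
proof -
  let ?I = "kac_indices n"
  define W where "W = {u. \<exists>c. u - (\<Sum>i\<in>?I. c i *\<^sub>U m i) \<in> J}"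
  note Jsub = uea.subspace_0[OF subspace] uea.subspace_add[OF subspace] uea.subspace_scale[OF subspace]
  have JW: "J \<subseteq> W" unfolding W_def by (auto intro!: exI[of _ "\<lambda>_. 0"])
  have W: "uea.subspace W"
  proof (rule uea.subspaceI)
    show "0 \<in> W" using JW Jsub(1) by blast
  next
    fix u v assume "u \<in> W" "v \<in> W"
    then obtain c d where "u - (\<Sum>i\<in>?I. c i *\<^sub>U m i) \<in> J" "v - (\<Sum>i\<in>?I. d i *\<^sub>U m i) \<in> J"
      unfolding W_def by blast
    from Jsub(2)[OF this] have "(u + v) - (\<Sum>i\<in>?I. (c i + d i) *\<^sub>U m i) \<in> J"
      by (simp add: uea.scale_left_distrib sum.distrib algebra_simps)
    then show "u + v \<in> W" unfolding W_def by (auto intro: exI[of _ "\<lambda>i. c i + d i"])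
  next
    fix r u assume "u \<in> W"
    then obtain c where "u - (\<Sum>i\<in>?I. c i *\<^sub>U m i) \<in> J"
      unfolding W_def by blast
    from Jsub(3)[OF this, of r] have "r *\<^sub>U u - (\<Sum>i\<in>?I. (r * c i) *\<^sub>U m i) \<in> J"
      by (simp add: uea.scale_right_diff_distrib uea.scale_sum_right)
    then show "r *\<^sub>U u \<in> W" unfolding W_def by (auto intro: exI[of _ "\<lambda>i. r * c i"])
  qed
  note Wsub = uea.subspace_0[OF W] uea.subspace_add[OF W] uea.subspace_scale[OF W] uea.subspace_diff[OF W] uea.subspace_neg[OF W]
  have mW: "m i \<in> W" for i
  proof (cases "i \<in> ?I")
    case True
    have "(\<Sum>j\<in>?I. (if j = i then 1 else 0) *\<^sub>U m j) = (\<Sum>j\<in>?I. if j = i then m j else 0)"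
      by (rule sum.cong) auto
    also have "\<dots> = m i" using True by simp
    finally have "m i - (\<Sum>j\<in>?I. (if j = i then 1 else 0) *\<^sub>U m j) \<in> J" using Jsub(1) by simp
    then show ?thesis unfolding W_def by (auto intro: exI[of _ "\<lambda>j. if j = i then 1 else 0"])
  next
    case False
    then show ?thesis using monomial_in_ideal[OF n] JW by blast
  qed
  have cong: "u \<in> W" if "u \<simeq> v" "v \<in> W" for u v
  proof -
    have "u - v \<in> W" using that JW by (auto simp: cong_def)
    from Wsub(2)[OF this that(2)] show ?thesis by simp
  qed
  have closed: "uea_gen x * w \<in> W" if w: "w \<in> W" and x: "\<And>i. uea_gen x * m i \<in> W" for x w
  proof -
    obtain c where c: "w - (\<Sum>i\<in>?I. c i *\<^sub>U m i) \<in> J" using w unfolding W_def by blast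
    have "uea_gen x * w \<simeq> uea_gen x * (\<Sum>i\<in>?I. c i *\<^sub>U m i)"
      by (rule cong_mult) (simp add: cong_def c)
    also have "\<dots> = (\<Sum>i\<in>?I. c i *\<^sub>U (uea_gen x * m i))" by (simp add: sum_distrib_left)
    finally show ?thesis by (rule cong) (intro uea.subspace_sum[OF W] Wsub(3) x)
  qed
  have X1: "uea_gen X1 * m i \<in> W" for i
    by (cases i) (simp_all only: X1_monomial Wsub mW)
  have Y3: "uea_gen Y3 * m i \<in> W" for i
    by (cases i) (simp_all only: Y3_monomial Wsub mW)
  have X3: "uea_gen X3 * m i \<in> W" for i
  proof (cases i)
    case (VA k) show ?thesis unfolding VA by (rule cong[OF X3_VA]) (intro Wsub mW)
  next
    case (VB k) show ?thesis unfolding VB by (rule cong[OF X3_VB]) (intro Wsub mW)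
  next
    case (VC k) show ?thesis unfolding VC by (rule cong[OF X3_VC]) (intro Wsub mW)
  next
    case (VD k) show ?thesis unfolding VD by (rule cong[OF X3_VD]) (intro Wsub mW)
  qed
  have Y1: "uea_gen Y1 * m i \<in> W" for i
  proof (cases i)
    case (VA k) show ?thesis unfolding VA by (rule cong[OF Y1_VA]) (intro Wsub mW)
  next
    case (VB k) show ?thesis unfolding VB by (rule cong[OF Y1_VB]) (intro Wsub mW)
  next
    case (VC k) show ?thesis unfolding VC by (rule cong[OF Y1_VC]) (intro Wsub mW)
  next
    case (VD k) show ?thesis unfolding VD by (rule cong[OF Y1_VD]) (intro Wsub mW)
  qed
  have "u * m (VA 0) \<in> W"
    by (rule subspace_closed_under_odd_root_vectors[OF W _ _ _ _ mW]; rule closed; (assumption | rule X1 Y3 X3 Y1))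
  then show ?thesis by (simp add: W_def)
qed

end


section \<open>The dimension of the generalized Kac module\<close>

lemma kac_indices_simps [simp]:
  "VA k \<in> kac_indices n \<longleftrightarrow> k \<le> n" "VB k \<in> kac_indices n \<longleftrightarrow> k < n" "VC k \<in> kac_indices n \<longleftrightarrow> k < n"
  "VD k \<in> kac_indices n \<longleftrightarrow> Suc k < n"
  by (auto simp: kac_indices_def)

definition tail :: "nat \<Rightarrow> (verma_index \<Rightarrow> complex) set" where
  "tail n = {f. \<forall>i\<in>kac_indices n. f i = 0}"

text \<open>For highest weight \<open>l = n\<close> the operators that lower the index or change the family carry a factor
  such as \<open>l - k\<close> exactly where they would lead from a basis vector in the tail to one outside.\<close>

lemma verma_op_tail:
  assumes f: "f \<in> tail n"
  shows "verma_op (of_nat n) a x f \<in> tail n"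
proof -
  have A: "f (VA k) = 0" if "k \<le> n" for k using f that by (simp add: tail_def)
  have B: "f (VB k) = 0" if "k < n" for k using f that by (simp add: tail_def)
  have C: "f (VC k) = 0" if "k < n" for k using f that by (simp add: tail_def)
  have D: "f (VD k) = 0" if "Suc k < n" for k using f that by (simp add: tail_def)
  have prev: "prev g k = 0" if "\<And>j. k = Suc j \<Longrightarrow> g j = 0" for g k
    using that by (cases k) auto
  \<comment> \<open>In each family the last index outside the tail is treated separately.\<close>
  have "verma_op (of_nat n) a x f (VA k) = 0" if "k \<le> n" for k
    using that by (cases "n = k") (simp_all add: A B C prev)
  moreover have "verma_op (of_nat n) a x f (VB k) = 0" if "k < n" for k
    using that by (cases "n = Suc k") (simp_all add: A B D prev)
  moreover have "verma_op (of_nat n) a x f (VC k) = 0" if "k < n" for k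
    using that by (cases "n = Suc k") (simp_all add: A C D prev)
  moreover have "verma_op (of_nat n) a x f (VD k) = 0" if "Suc k < n" for k
    using that by (cases "n = Suc (Suc k)") (simp_all add: B C D prev)
  ultimately show ?thesis
    unfolding tail_def by (auto simp: kac_indices_def simp del: verma_op.simps)
qed

lemma verma_act_tail:
  assumes f: "f \<in> tail n"
  shows "verma_act (of_nat n) a u f \<in> tail n"
proof (induction u rule: uea_induct)
  case (gen x u)
  then show ?case by (simp add: verma_act_mult verma_op_tail)
qed (use f in \<open>auto simp: tail_def verma_act_add\<close>)

definition delta :: "verma_index \<Rightarrow> verma_index \<Rightarrow> complex" where
  "delta i j = (if j = i then 1 else 0)"

lemma verma_op_delta:
  "verma_op l a Y2 (delta (VA k)) = delta (VA (Suc k))"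
  "verma_op l a X1 (delta (VA k)) = delta (VB k)"
  "verma_op l a Y3 (delta (VA k)) = delta (VC k)"
  "verma_op l a X1 (delta (VC k)) = (\<lambda>i. delta (VD k) i - a * delta (VA (Suc k)) i)"
  by (rule ext, rename_tac i, case_tac i; rename_tac j, case_tac j; simp add: delta_def mat_of_basis)+

lemma verma_act_monomial: "verma_act l a (verma_monomial a i) (delta (VA 0)) = delta i"
proof -
  have Y2: "verma_act l a (Y2_pow k) (delta (VA 0)) = delta (VA k)" for k
    by (induction k) (simp_all add: verma_act_mult verma_op_delta)
  show ?thesis
    by (cases i) (auto simp: verma_act_mult verma_act_add verma_op_delta Y2 simp flip: power_Suc)
qed

lemma verma_act_sum:
  "verma_act l a (\<Sum>i\<in>S. g i) f j = (\<Sum>i\<in>S. verma_act l a (g i) f j)"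
  by (induction S rule: infinite_finite_induct) (simp_all add: verma_act_add)

text \<open>The annihilator of the highest weight vector in the Verma module modulo its tail.  The generalized
  Kac ideal is contained in it, which bounds the Kac module from below.\<close>

definition verma_ann :: "nat \<Rightarrow> complex \<Rightarrow> uea set" where
  "verma_ann n a = {u. verma_act (of_nat n) a u (delta (VA 0)) \<in> tail n}"

lemma left_ideal_verma_ann: "left_ideal (verma_ann n a)"
  unfolding left_ideal_def verma_ann_def
  using verma_act_tail by (auto simp: verma_act_mult) (auto simp: tail_def verma_act_add)

text \<open>Applied to the highest weight vector, the monomials produce the coordinate vectors.\<close>

lemma verma_ann_independent:
  assumes "(\<Sum>i\<in>kac_indices n. c i *\<^sub>U verma_monomial a i) \<in> verma_ann n a" "j \<in> kac_indices n"
  shows "c j = 0"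
proof -
  have "0 = verma_act (of_nat n) a (\<Sum>i\<in>kac_indices n. c i *\<^sub>U verma_monomial a i) (delta (VA 0)) j"
    using assms by (simp add: verma_ann_def tail_def)
  also have "\<dots> = (\<Sum>i\<in>kac_indices n. if j = i then c i else 0)"
    unfolding verma_act_sum verma_act_scale verma_act_monomial
    by (rule sum.cong) (auto simp: delta_def)
  also have "\<dots> = c j" using assms(2) by simp
  finally show ?thesis by simp
qed

lemma weights_cartan:
  assumes "\<mu> \<in> weights"
  shows "\<mu> (scale_sl12 c H1 + scale_sl12 d H2) = c * \<mu> H1 + d * \<mu> H2"
proof -
  have c: "H1 \<in> cartan" "H2 \<in> cartan" "scale_sl12 c H1 \<in> cartan" "scale_sl12 d H2 \<in> cartan"
    unfolding cartan_def by (auto intro: sl12.span_base sl12.span_scale)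
  then show ?thesis using assms by (simp add: weights_def)
qed

definition kac_gens :: "(sl12 \<Rightarrow> complex) \<Rightarrow> nat \<Rightarrow> uea set" where
  "kac_gens \<mu> n = {uea_gen x | x. x \<in> n_plus} \<union> {uea_gen h - uea_scalar (\<mu> h) | h. h \<in> cartan} \<union> {Y2_pow (n + 1)}"

lemma kac_ideal_eq: "\<mu> H2 = of_nat n \<Longrightarrow> kac_ideal \<mu> = left_ideal hull (kac_gens \<mu> n)"
  by (simp add: kac_ideal_def kac_gens_def)

lemma left_ideal_hull: "left_ideal (left_ideal hull S)"
  by (rule hull_in) (auto simp: left_ideal_def)

text \<open>For \<open>n \<ge> 1\<close> the number \<open>a = \<mu> H1 / n - 1\<close> satisfies the last condition; for \<open>n = 0\<close> the condition forces
  \<open>\<mu>\<close> to be the zero weight.\<close>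

locale kac_weight =
  fixes \<mu> :: "sl12 \<Rightarrow> complex" and n :: nat and a :: complex
  assumes weight: "\<mu> \<in> weights" and H2_weight: "\<mu> H2 = of_nat n" and H1_weight: "\<mu> H1 = of_nat n * (1 + a)"
begin

lemma kac_gens_subset_verma_ann: "kac_gens \<mu> n \<subseteq> verma_ann n a"
proof -
  have "uea_gen x \<in> verma_ann n a" if n_plus: "x \<in> n_plus" for x
  proof -
    obtain c d e where x: "x = scale_sl12 c Y1 + scale_sl12 d X2 + scale_sl12 e X3"
      using n_plus by (auto simp: n_plus_eq)
    have "verma_op (of_nat n) a x (delta (VA 0)) i = 0" for i
      by (cases i; rename_tac k, case_tac k) (simp_all add: x mat_of_sl12_linear mat_of_basis delta_def)
    then show ?thesis by (simp add: verma_ann_def tail_def)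
  qed
  moreover have "uea_gen h - uea_scalar (\<mu> h) \<in> verma_ann n a" if cartan: "h \<in> cartan" for h
  proof -
    obtain c d where h: "h = scale_sl12 c H1 + scale_sl12 d H2"
      using cartan by (auto simp: cartan_eq)
    have "verma_act (of_nat n) a (uea_scalar (\<mu> h)) f i = \<mu> h * f i" for f i
      using verma_act_scale[of "of_nat n" a "\<mu> h" 1 f i] by (simp add: uea_scale_def)
    moreover have "verma_op (of_nat n) a h (delta (VA 0)) i = \<mu> h * delta (VA 0) i" for i
      unfolding h weights_cartan[OF weight]
      by (cases i; rename_tac k, case_tac k)
        (simp_all add: mat_of_sl12_linear mat_of_basis delta_def H1_weight H2_weight algebra_simps)
    ultimately show ?thesis by (simp add: verma_ann_def tail_def verma_act_diff)
  qed
  moreover have "Y2_pow (n + 1) \<in> verma_ann n a"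
    using verma_act_monomial[of "of_nat n" a "VA (n + 1)"]
    by (auto simp: verma_ann_def tail_def delta_def)
  ultimately show ?thesis unfolding kac_gens_def by blast
qed

lemma hw_idealI:
  assumes "left_ideal J" "kac_gens \<mu> n \<subseteq> J"
  shows "hw_ideal J (of_nat n) a"
proof
  have "Y1 \<in> n_plus" "X3 \<in> n_plus" "H1 \<in> cartan" "H2 \<in> cartan"
    by (auto simp: n_plus_def cartan_def intro: sl12.span_base)
  then have "uea_gen Y1 \<in> kac_gens \<mu> n" "uea_gen X3 \<in> kac_gens \<mu> n"
    "uea_gen H1 - uea_scalar (\<mu> H1) \<in> kac_gens \<mu> n" "uea_gen H2 - uea_scalar (\<mu> H2) \<in> kac_gens \<mu> n"
    unfolding kac_gens_def by auto
  then show "uea_gen Y1 \<in> J" "uea_gen X3 \<in> J"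
    "uea_gen H1 - uea_scalar (of_nat n * (1 + a)) \<in> J" "uea_gen H2 - uea_scalar (of_nat n) \<in> J"
    using assms(2) by (auto simp: H1_weight H2_weight)
qed (rule assms)

lemma spanning:
  assumes "left_ideal J" "kac_gens \<mu> n \<subseteq> J"
  shows "\<exists>c. u - (\<Sum>i\<in>kac_indices n. c i *\<^sub>U verma_monomial a i) \<in> J"
proof (rule hw_ideal.kac_spanning[OF hw_idealI[OF assms] refl])
  show "Y2_pow (n + 1) \<in> J" using assms(2) unfolding kac_gens_def by blast
qed

lemma kac_module_fin_dim: "finite_dimensional (kac_module \<mu>)"
  unfolding kac_module_def kac_ideal_eq[of \<mu> n, OF H2_weight]
  by (rule uea_quotient_fin_dim[OF left_ideal_hull finite_kac_indices spanning[OF left_ideal_hull hull_subset]])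

lemma kac_module_dim:
  assumes "n \<ge> 1"
  shows "module_dim (kac_module \<mu>) = 4 * n"
proof -
  have sub: "left_ideal hull (kac_gens \<mu> n) \<subseteq> verma_ann n a"
    by (rule hull_minimal[of _ _ left_ideal, OF kac_gens_subset_verma_ann left_ideal_verma_ann])
  have "module_dim (kac_module \<mu>) = card (kac_indices n)"
    unfolding kac_module_def kac_ideal_eq[of \<mu> n, OF H2_weight]
    by (rule uea_quotient_dim[OF left_ideal_hull finite_kac_indices spanning[OF left_ideal_hull hull_subset]])
      (rule verma_ann_independent, rule subsetD[OF sub])
  then show ?thesis using card_kac_indices[OF assms] by simp
qed

end


section \<open>The irreducible quotient\<close>

lemma sl12_homogeneous_add: "x \<in> sl12_homogeneous p \<Longrightarrow> y \<in> sl12_homogeneous p \<Longrightarrow> x + y \<in> sl12_homogeneous p"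
  by (simp add: sl12_homogeneous_def mat_of_sl12_linear)

lemma sl12_homogeneous_scale: "x \<in> sl12_homogeneous p \<Longrightarrow> scale_sl12 c x \<in> sl12_homogeneous p"
  by (simp add: sl12_homogeneous_def mat_of_sl12_linear)

lemma sl12_homogeneous_split: "\<exists>x0\<in>sl12_homogeneous 0. \<exists>x1\<in>sl12_homogeneous 1. x = x0 + x1"
proof -
  let ?A = "mat_of_sl12 x"
  let ?x0 = "scale_sl12 (?A$2$3) X2 + scale_sl12 (?A$3$2) Y2 + scale_sl12 (?A$1$1) H1 + scale_sl12 (- ?A$3$3) H2"
  let ?x1 = "scale_sl12 (?A$1$2) X1 + scale_sl12 (?A$1$3) X3 + scale_sl12 (?A$2$1) Y1 + scale_sl12 (?A$3$1) Y3"
  have "x = ?x0 + ?x1" by (subst sl12_expansion) (simp add: algebra_simps)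
  moreover have "?x0 \<in> sl12_homogeneous 0" "?x1 \<in> sl12_homogeneous 1"
    by (intro sl12_homogeneous_add sl12_homogeneous_scale basis_homogeneous)+
  ultimately show ?thesis by blast
qed

lemma uea_homogeneous_scale: "uea_homogeneous p u \<Longrightarrow> uea_homogeneous p (c *\<^sub>U u)"
  unfolding uea_scale_def by (rule uea_homogeneous.scale)

lemma uea_homogeneous_uminus: "uea_homogeneous p u \<Longrightarrow> uea_homogeneous p (- u)"
  using uea_homogeneous_scale[of p u "- 1"] by simp

lemma uea_homogeneous_diff: "uea_homogeneous p u \<Longrightarrow> uea_homogeneous p v \<Longrightarrow> uea_homogeneous p (u - v)"
  using uea_homogeneous.add[of p u "- v"] uea_homogeneous_uminus by simp

lemma uea_homogeneous_split: "\<exists>u0 u1. uea_homogeneous 0 u0 \<and> uea_homogeneous 1 u1 \<and> u = u0 + u1"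
proof (induction u rule: uea_induct)
  case one
  show ?case by (rule exI[of _ 1], rule exI[of _ 0]) (auto intro: uea_homogeneous.intros)
next
  case (gen x u)
  then obtain u0 u1 where u: "uea_homogeneous 0 u0" "uea_homogeneous 1 u1" "u = u0 + u1" by blast
  obtain x0 x1 where x: "x0 \<in> sl12_homogeneous 0" "x1 \<in> sl12_homogeneous 1" "x = x0 + x1"
    using sl12_homogeneous_split by blast
  have "uea_homogeneous 0 (uea_gen x0 * u0 + uea_gen x1 * u1)"
    "uea_homogeneous 1 (uea_gen x0 * u1 + uea_gen x1 * u0)"
    using uea_homogeneous.gen[OF x(1) u(1)] uea_homogeneous.gen[OF x(1) u(2)]
      uea_homogeneous.gen[OF x(2) u(1)] uea_homogeneous.gen[OF x(2) u(2)]
    by (auto intro: uea_homogeneous.add)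
  moreover have "uea_gen x * u = (uea_gen x0 * u0 + uea_gen x1 * u1) + (uea_gen x0 * u1 + uea_gen x1 * u0)"
    unfolding x u uea_gen_add by (simp add: algebra_simps)
  ultimately show ?case by blast
next
  case (add u v)
  then obtain u0 u1 v0 v1 where "uea_homogeneous 0 u0" "uea_homogeneous 1 u1" "u = u0 + u1"
     "uea_homogeneous 0 v0" "uea_homogeneous 1 v1" "v = v0 + v1" by blast
  then show ?case
    by (intro exI[of _ "u0 + v0"] exI[of _ "u1 + v1"]) (auto intro: uea_homogeneous.add)
next
  case (scale c u)
  then obtain u0 u1 where "uea_homogeneous 0 u0" "uea_homogeneous 1 u1" "u = u0 + u1" by blast
  then show ?case
    by (intro exI[of _ "c *\<^sub>U u0"] exI[of _ "c *\<^sub>U u1"])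
      (auto intro: uea_homogeneous_scale simp: uea.scale_right_distrib)
qed

lemma uea_quotient_minus:
  assumes "left_ideal J"
  shows "uea_coset J u \<ominus>\<^bsub>uea_quotient J\<^esub> uea_coset J v = uea_coset J (u - v)"
proof -
  interpret vectorspace complex_ring "uea_quotient J" by (rule vectorspace_uea_quotient[OF assms])
  have "\<ominus>\<^bsub>uea_quotient J\<^esub> uea_coset J v = uea_coset J (- v)"
    by (rule M.minus_equality) (simp_all add: uea_quotient_simps assms)
  then show ?thesis by (simp add: a_minus_def uea_quotient_simps assms)
qed

text \<open>The homogeneous parts of the quotient sum up to all of it because those of the enveloping algebra
  do.  Their sum is direct because \<open>J\<close> is assumed to contain the homogeneous parts of its elements.\<close>

lemma sl12_module_uea_quotient:
  assumes J: "left_ideal J"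
    and graded: "\<And>u0 u1. uea_homogeneous 0 u0 \<Longrightarrow> uea_homogeneous 1 u1 \<Longrightarrow> u0 + u1 \<in> J \<Longrightarrow> u0 \<in> J"
  shows "sl12_module (uea_quotient J)"
proof -
  interpret V: vectorspace complex_ring "uea_quotient J" by (rule vectorspace_uea_quotient[OF J])
  note simps = uea_quotient_simps uea_quotient_minus uea_quotient_component J
  note Jsub = left_ideal_subspace[OF J]
  show ?thesis
  proof (intro sl12_module.intro V.vectorspace_axioms sl12_module_axioms.intro)
    fix p
    show "VectorSpace.subspace complex_ring (component (uea_quotient J) p) (uea_quotient J)"
      unfolding VectorSpace.subspace_def
    proof
      show "vectorspace complex_ring (uea_quotient J)" by (rule V.vectorspace_axioms)
      show "submodule complex_ring (component (uea_quotient J) p) (uea_quotient J)"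
        by standard (auto simp: simps intro: uea_homogeneous.intros uea_homogeneous_scale)
    qed
  next
    fix X assume "X \<in> carrier (uea_quotient J)"
    then obtain u where X: "X = uea_coset J u" by (auto simp: simps)
    obtain u0 u1 where u: "uea_homogeneous 0 u0" "uea_homogeneous 1 u1" "u = u0 + u1"
      using uea_homogeneous_split by blast
    have uniq: "uea_coset J w0 = uea_coset J u0 \<and> uea_coset J w1 = uea_coset J u1"
      if w: "uea_homogeneous 0 w0" "uea_homogeneous 1 w1" "uea_coset J u = uea_coset J (w0 + w1)" for w0 w1
    proof -
      have "(w0 + w1) - u \<in> J" using w(3) by (metis uea_coset_eq_iff[OF J])
      then have sum: "(w0 - u0) + (w1 - u1) \<in> J" by (simp add: u algebra_simps)
      have 0: "w0 - u0 \<in> J"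
        by (rule graded[OF _ _ sum]) (intro uea_homogeneous_diff w u)+
      moreover have "w1 - u1 \<in> J" using uea.subspace_diff[OF Jsub sum 0] by simp
      ultimately show ?thesis by (simp add: uea_coset_eq_iff[OF J])
    qed
    show "\<exists>!(v0, v1). v0 \<in> component (uea_quotient J) 0 \<and> v1 \<in> component (uea_quotient J) 1
        \<and> X = v0 \<oplus>\<^bsub>uea_quotient J\<^esub> v1"
    proof (rule ex1I[of _ "(uea_coset J u0, uea_coset J u1)"])
      show "case (uea_coset J u0, uea_coset J u1) of (v0, v1) \<Rightarrow> v0 \<in> component (uea_quotient J) 0
          \<and> v1 \<in> component (uea_quotient J) 1 \<and> X = v0 \<oplus>\<^bsub>uea_quotient J\<^esub> v1"
        using u by (auto simp: simps X)
    next
      fix P assume "case P of (v0, v1) \<Rightarrow> v0 \<in> component (uea_quotient J) 0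
          \<and> v1 \<in> component (uea_quotient J) 1 \<and> X = v0 \<oplus>\<^bsub>uea_quotient J\<^esub> v1"
      then obtain w0 w1 where "P = (uea_coset J w0, uea_coset J w1)" "uea_homogeneous 0 w0" "uea_homogeneous 1 w1"
         "X = uea_coset J (w0 + w1)"
        by (auto simp: simps split: prod.splits)
      then show "P = (uea_coset J u0, uea_coset J u1)" using uniq X by auto
    qed
  next
    fix x p q and X assume x: "x \<in> sl12_homogeneous p" "X \<in> component (uea_quotient J) q"
    then obtain u where "X = uea_coset J u" "uea_homogeneous q u" by (auto simp: simps)
    with uea_homogeneous.gen[OF x(1) this(2)]
    show "act (uea_quotient J) x X \<in> component (uea_quotient J) (p + q)"
      by (simp add: simps)
  next
    fix x y p q X assume "x \<in> sl12_homogeneous p" "y \<in> sl12_homogeneous q" "X \<in> carrier (uea_quotient J)"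
    then show "act (uea_quotient J) (superbracket x y) X
           = act (uea_quotient J) x (act (uea_quotient J) y X)
             \<ominus>\<^bsub>uea_quotient J\<^esub> super_sign p q \<odot>\<^bsub>uea_quotient J\<^esub> act (uea_quotient J) y (act (uea_quotient J) x X)"
      by (auto simp: simps uea_gen_superbracket left_diff_distrib mult.assoc uea_scale_def)
  qed (auto simp: simps uea_gen_add uea_gen_scale distrib_left distrib_right)
qed

text \<open>The parity of a basis vector, with \<open>v\<close> even: it is the number of odd factors \<open>X1\<close>, \<open>Y3\<close> modulo 2.\<close>

fun index_degree :: "verma_index \<Rightarrow> bit" where
  "index_degree (VA k) = 0" | "index_degree (VB k) = 1" | "index_degree (VC k) = 1" | "index_degree (VD k) = 0"

definition pure :: "bit \<Rightarrow> (verma_index \<Rightarrow> complex) \<Rightarrow> bool" where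
  "pure p f \<longleftrightarrow> (\<forall>i. index_degree i \<noteq> p \<longrightarrow> f i = 0)"

lemma verma_op_pure:
  assumes "x \<in> sl12_homogeneous p" "pure q f"
  shows "pure (p + q) (verma_op l a x f)"
proof -
  have prev: "prev g k = 0" if "\<And>j. g j = 0" for g k
    using that by (cases k) auto
  show ?thesis
    unfolding pure_def
  proof (intro allI impI)
    fix i assume "index_degree i \<noteq> p + q"
    then show "verma_op l a x f i = 0"
      using assms by (cases i; cases p; cases q) (auto simp: pure_def sl12_homogeneous_iff prev)
  qed
qed

lemma verma_act_pure:
  assumes "uea_homogeneous p u" "pure q f"
  shows "pure (p + q) (verma_act l a u f)"
  using assms(1)
proof induction
  case (gen x p r u)
  then show ?case using verma_op_pure[OF gen(1) gen(3), of l a]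
    by (simp only: verma_act_mult verma_act_gen add.assoc)
next
  case (scale p u c)
  then show ?case by (simp add: pure_def flip: uea_scale_def)
qed (use assms(2) in \<open>auto simp: pure_def verma_act_add\<close>)

text \<open>The largest proper submodule of the Verma module consists of the vectors whose translates all have
  coefficient 0 at \<open>v\<close>.  This is the annihilator of \<open>v\<close> modulo that submodule.\<close>

definition irreducible_ideal :: "nat \<Rightarrow> complex \<Rightarrow> uea set" where
  "irreducible_ideal n a = {u. \<forall>w. verma_act (of_nat n) a (w * u) (delta (VA 0)) (VA 0) = 0}"

lemma left_ideal_irreducible_ideal: "left_ideal (irreducible_ideal n a)"
  unfolding left_ideal_def irreducible_ideal_def
  by (auto simp: distrib_left verma_act_add simp flip: mult.assoc)

lemma verma_ann_subset_irreducible_ideal: "verma_ann n a \<subseteq> irreducible_ideal n a"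
proof
  fix u assume u: "u \<in> verma_ann n a"
  have "w * u \<in> verma_ann n a" for w using left_ideal_mult[OF left_ideal_verma_ann u] .
  then show "u \<in> irreducible_ideal n a" by (simp add: irreducible_ideal_def verma_ann_def tail_def)
qed

lemma one_notin_irreducible_ideal: "1 \<notin> irreducible_ideal n a"
proof
  assume "1 \<in> irreducible_ideal n a"
  then have "verma_act (of_nat n) a (1 * 1) (delta (VA 0)) (VA 0) = 0"
    unfolding irreducible_ideal_def by blast
  then show False by (simp add: delta_def)
qed

text \<open>Since \<open>v\<close> is even, only the even part \<open>w0 u0 + w1 u1\<close> of a product contributes to the coefficient at
  \<open>v\<close>; pairing \<open>u0 + u1\<close> with the even part \<open>w0\<close> alone isolates \<open>u0\<close>.\<close>

lemma irreducible_ideal_graded: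
  assumes u: "uea_homogeneous 0 u0" "uea_homogeneous 1 u1" "u0 + u1 \<in> irreducible_ideal n a"
  shows "u0 \<in> irreducible_ideal n a"
  unfolding irreducible_ideal_def
proof (safe)
  fix w
  let ?v = "delta (VA 0)" let ?c = "\<lambda>u. verma_act (of_nat n) a u ?v (VA 0)"
  obtain w0 w1 where w: "uea_homogeneous 0 w0" "uea_homogeneous 1 w1" "w = w0 + w1"
    using uea_homogeneous_split by blast
  have v: "pure 0 ?v" by (auto simp: pure_def delta_def)
  have "?c (w1 * u0) = 0" "?c (w0 * u1) = 0"
    using verma_act_pure[OF w(2) verma_act_pure[OF u(1) v]] verma_act_pure[OF w(1) verma_act_pure[OF u(2) v]]
    by (auto simp: verma_act_mult pure_def)
  moreover have "?c (w0 * (u0 + u1)) = 0" using u(3) by (auto simp: irreducible_ideal_def)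
  ultimately show "?c (w * u0) = 0" by (simp add: w distrib_left distrib_right verma_act_add)
qed

fun H2_eigenvalue :: "nat \<Rightarrow> verma_index \<Rightarrow> complex" where
  "H2_eigenvalue n (VA k) = of_nat n - of_nat (2 * k)"
| "H2_eigenvalue n (VB k) = of_nat n - of_nat (2 * k + 1)"
| "H2_eigenvalue n (VC k) = of_nat n - of_nat (2 * k + 1)"
| "H2_eigenvalue n (VD k) = of_nat n - of_nat (2 * k + 2)"

lemma verma_op_H2: "verma_op (of_nat n) a H2 f i = H2_eigenvalue n i * f i"
  by (cases i) (simp_all add: mat_of_basis algebra_simps)

text \<open>The product of \<open>H2 - s\<close> over the \<open>m\<close> numbers \<open>s = n - 1, n - 2, \<dots>, n - m\<close>.\<close>

fun top_projector :: "nat \<Rightarrow> nat \<Rightarrow> uea" where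
  "top_projector n 0 = 1"
| "top_projector n (Suc j) = (uea_gen H2 - (of_nat n - of_nat (Suc j)) *\<^sub>U 1) * top_projector n j"

lemma verma_act_top_projector:
  "verma_act (of_nat n) a (top_projector n m) f i = (\<Prod>j<m. H2_eigenvalue n i - (of_nat n - of_nat (Suc j))) * f i"
proof (induction m)
  case (Suc m)
  let ?g = "verma_act (of_nat n) a (top_projector n m) f"
  have "verma_act (of_nat n) a (top_projector n (Suc m)) f i
      = H2_eigenvalue n i * ?g i - (of_nat n - of_nat (Suc m)) * ?g i"
    unfolding top_projector.simps verma_act_mult
    by (simp only: verma_act_diff verma_act_scale verma_act_gen verma_act_one verma_op_H2)
  then show ?case by (simp add: Suc algebra_simps)
qed simp

text \<open>Outside the tail the eigenvalues of \<open>H2\<close> are \<open>n\<close>, attained at \<open>VA 0\<close> only, and numbers among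
  \<open>n - 1, \<dots>, - n\<close>.  So the product of \<open>2 n\<close> factors kills all of them but the highest one, where it
  is \<open>(2 n)!\<close>.\<close>

lemma top_projector_delta:
  "\<exists>c. c \<noteq> 0 \<and> (\<forall>f. (\<lambda>i. verma_act (of_nat n) a (top_projector n (2 * n)) f i - c * f (VA 0) * delta (VA 0) i) \<in> tail n)"
proof -
  define c where "c = (\<Prod>j<2 * n. of_nat (Suc j) :: complex)"
  have "c \<noteq> 0" by (simp add: c_def del: of_nat_Suc)
  moreover have "verma_act (of_nat n) a (top_projector n (2 * n)) f i = c * f (VA 0) * delta (VA 0) i"
    if i: "i \<in> kac_indices n" for f i
  proof (cases "i = VA 0")
    case True
    then show ?thesis by (simp add: verma_act_top_projector c_def delta_def)
  next
    case False
    obtain s where s: "H2_eigenvalue n i = of_nat n - of_nat (Suc s)" "s < 2 * n"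
    proof (cases i)
      case (VA k) then show ?thesis using that[of "2 * k - 1"] i False by (cases k) auto
    next
      case (VB k) then show ?thesis using that[of "2 * k"] i by auto
    next
      case (VC k) then show ?thesis using that[of "2 * k"] i by auto
    next
      case (VD k) then show ?thesis using that[of "2 * k + 1"] i by auto
    qed
    then have "(\<Prod>j<2 * n. H2_eigenvalue n i - (of_nat n - of_nat (Suc j))) = 0"
      by (auto simp: prod_zero_iff simp del: of_nat_Suc)
    then show ?thesis using False by (simp add: verma_act_top_projector delta_def)
  qed
  ultimately show ?thesis by (intro exI[of _ c]) (auto simp: tail_def)
qed

text \<open>If \<open>w u v\<close> has a nonzero coefficient at \<open>v\<close>, projecting to the highest weight line turns \<open>w u v\<close> into
  a nonzero multiple of \<open>v\<close>.  So every nonzero vector of the quotient generates it.\<close>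

lemma irreducible_ideal_reaches_one:
  assumes "u \<notin> irreducible_ideal n a"
  obtains w where "w * u - 1 \<in> irreducible_ideal n a"
proof -
  let ?act = "verma_act (of_nat n) a" let ?v = "delta (VA 0)"
  obtain w where w: "?act (w * u) ?v (VA 0) \<noteq> 0"
    using assms by (auto simp: irreducible_ideal_def)
  obtain c where c: "c \<noteq> 0" "\<And>f. (\<lambda>i. ?act (top_projector n (2 * n)) f i - c * f (VA 0) * ?v i) \<in> tail n"
    using top_projector_delta[of n a] by blast
  define d where "d = c * ?act (w * u) ?v (VA 0)"
  have "d \<noteq> 0" using c(1) w by (simp add: d_def)
  have "top_projector n (2 * n) * (w * u) - d *\<^sub>U 1 \<in> verma_ann n a"
    using c(2)[of "?act (w * u) ?v"]
    by (simp add: verma_ann_def tail_def verma_act_diff d_def verma_act_mult)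
  from uea.subspace_scale[OF left_ideal_subspace[OF left_ideal_verma_ann] this, of "inverse d"]
  have "(inverse d *\<^sub>U (top_projector n (2 * n) * w)) * u - 1 \<in> verma_ann n a"
    using c(1) w by (simp add: \<open>d \<noteq> 0\<close> uea.scale_right_diff_distrib mult.assoc)
  then show ?thesis using that verma_ann_subset_irreducible_ideal by blast
qed

lemma sl12_submodule_is_submodule: "sl12_submodule M N \<Longrightarrow> submodule complex_ring N M"
  by (simp add: sl12_submodule_def VectorSpace.subspace_def)

lemma sl12_submodule_uea_closed:
  assumes J: "left_ideal J" and N: "sl12_submodule (uea_quotient J) N"
    and u: "uea_coset J u \<in> N"
  shows "uea_coset J (w * u) \<in> N"
proof -
  have sub: "submodule complex_ring N (uea_quotient J)"
    using N by (rule sl12_submodule_is_submodule)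
  show ?thesis
  proof (induction w rule: uea_induct)
    case (gen x w)
    then have "act (uea_quotient J) x (uea_coset J (w * u)) \<in> N"
      using N by (simp add: sl12_submodule_def)
    then show ?case by (simp add: uea_quotient_act[OF J] mult.assoc)
  next
    case (add v w)
    from submodule.m_closed[OF sub this] show ?case by (simp add: uea_quotient_add[OF J] distrib_right)
  next
    case (scale c w)
    from submodule.smult_closed[OF sub _ this, of c] show ?case by (simp add: uea_quotient_smult[OF J])
  qed (use u in simp)
qed

lemma sl12_submodule_with_generator:
  assumes J: "left_ideal J" and N: "sl12_submodule (uea_quotient J) N" and 1: "uea_coset J 1 \<in> N"
  shows "N = carrier (uea_quotient J)"
proof
  show "N \<subseteq> carrier (uea_quotient J)"
    by (rule submodule.subset[OF sl12_submodule_is_submodule[OF N]])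
  show "carrier (uea_quotient J) \<subseteq> N"
    using sl12_submodule_uea_closed[OF assms] by (auto simp: uea_quotient_carrier)
qed

context kac_weight begin

text \<open>The ideal contains the generators of the Kac ideal, so the quotient inherits the spanning set of
  the Kac module, and the class of 1 is a highest weight vector.\<close>

lemma irreducible_quotient_in_P_plus: "\<mu> \<in> P_plus"
proof -
  let ?J = "irreducible_ideal n a" let ?L = "uea_quotient ?J"
  note J = left_ideal_irreducible_ideal[of n a]
  have gens: "kac_gens \<mu> n \<subseteq> ?J"
    using kac_gens_subset_verma_ann verma_ann_subset_irreducible_ideal by blast
  have module: "sl12_module ?L"
    by (rule sl12_module_uea_quotient[OF J irreducible_ideal_graded])
  have one: "uea_coset ?J 1 \<noteq> \<zero>\<^bsub>?L\<^esub>"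
    using one_notin_irreducible_ideal by (simp add: uea_quotient_zero[OF J] uea_coset_eq_iff[OF J])
  have "irreducible_module ?L"
    unfolding irreducible_module_def
  proof (intro conjI allI impI module)
    show "carrier ?L \<noteq> {\<zero>\<^bsub>?L\<^esub>}" using one by (auto simp: uea_quotient_carrier)
  next
    fix N assume N: "sl12_submodule ?L N"
    then have "N \<subseteq> carrier ?L" "\<zero>\<^bsub>?L\<^esub> \<in> N"
      by (auto dest!: sl12_submodule_is_submodule intro: submodule.zero_closed submodule.subset[THEN subsetD])
    have "N = carrier ?L" if nonzero: "N \<noteq> {\<zero>\<^bsub>?L\<^esub>}"
    proof -
      obtain X where "X \<in> N" "X \<noteq> \<zero>\<^bsub>?L\<^esub>"
        using nonzero \<open>\<zero>\<^bsub>?L\<^esub> \<in> N\<close> by blast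
      then obtain u where u: "uea_coset ?J u \<in> N" "uea_coset ?J u \<noteq> \<zero>\<^bsub>?L\<^esub>"
        using \<open>N \<subseteq> carrier ?L\<close> unfolding uea_quotient_carrier by blast
      then have "u \<notin> ?J" by (simp add: uea_quotient_zero[OF J] uea_coset_eq_iff[OF J])
      then obtain w where "w * u - 1 \<in> ?J" by (rule irreducible_ideal_reaches_one)
      then have "uea_coset ?J (w * u) = uea_coset ?J 1" by (simp add: uea_coset_eq_iff[OF J])
      then show ?thesis using sl12_submodule_with_generator[OF J N] sl12_submodule_uea_closed[OF J N u(1), of w] by simp
    qed
    then show "N = {\<zero>\<^bsub>?L\<^esub>} \<or> N = carrier ?L" by blast
  qed
  moreover have "highest_weight_module ?L \<mu>"
    unfolding highest_weight_module_def
  proof (intro conjI module exI bexI)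
    show "uea_coset ?J 1 \<in> component ?L 0"
      by (auto simp: uea_quotient_component intro: uea_homogeneous.one)
    have "act ?L x (uea_coset ?J 1) = \<zero>\<^bsub>?L\<^esub>" if "x \<in> n_plus" for x
      using gens that
      by (auto simp: uea_quotient_act[OF J] uea_quotient_zero[OF J] uea_coset_eq_iff[OF J] kac_gens_def)
    moreover have "act ?L h (uea_coset ?J 1) = \<mu> h \<odot>\<^bsub>?L\<^esub> uea_coset ?J 1" if "h \<in> cartan" for h
      using gens that
      by (auto simp: uea_quotient_act[OF J] uea_quotient_smult[OF J] uea_coset_eq_iff[OF J] kac_gens_def uea_scale_def)
    ultimately show "highest_weight_vector ?L \<mu> (uea_coset ?J 1)"
      using one by (simp add: highest_weight_vector_def uea_quotient_carrier)
    show "\<forall>N. sl12_submodule ?L N \<and> uea_coset ?J 1 \<in> N \<longrightarrow> N = carrier ?L"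
      using sl12_submodule_with_generator[OF J] by blast
  qed
  moreover have "finite_dimensional ?L"
    by (rule uea_quotient_fin_dim[OF J finite_kac_indices spanning[OF J gens]])
  ultimately show ?thesis unfolding P_plus_def using weight by blast
qed

end


section \<open>Finite-dimensional highest weight modules\<close>

context sl12_module begin

lemma smult_eq_zeroD:
  assumes "c \<odot> v = \<zero>" "c \<noteq> 0" "v \<in> carrier M"
  shows "v = \<zero>"
proof -
  have "v = (inverse c * c) \<odot> v" using assms(2,3) smult_one[of v] by simp
  also have "\<dots> = inverse c \<odot> (c \<odot> v)" using assms(3) smult_assoc1[of "inverse c" c v] by simp
  also have "\<dots> = \<zero>" using assms(1) smult_r_null[of "inverse c"] by simp
  finally show ?thesis .
qed

lemma zero_smult: "v \<in> carrier M \<Longrightarrow> 0 \<odot> v = \<zero>"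
  using smult_l_null[of v] by simp

lemma smult_zero: "c \<odot> \<zero> = \<zero>"
  using smult_r_null[of c] by simp

lemma act_zero: "act M x \<zero> = \<zero>"
  using act_smult[of \<zero> x 0] act_closed[of \<zero> x] by (simp add: zero_smult)

lemma act_swap:
  assumes "x \<in> sl12_homogeneous p" "y \<in> sl12_homogeneous q" "v \<in> carrier M"
  shows "act M x (act M y v) = act M (superbracket x y) v \<oplus> super_sign p q \<odot> act M y (act M x v)"
proof -
  have "A = (A \<ominus> B) \<oplus> B" if "A \<in> carrier M" "B \<in> carrier M" for A B
    using that by (simp add: a_minus_def M.a_assoc M.l_neg)
  from this[of "act M x (act M y v)" "super_sign p q \<odot> act M y (act M x v)"]
  show ?thesis using assms by (simp add: act_superbracket act_closed)
qed

lemma funpow_act: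
  assumes "v \<in> carrier M"
  shows funpow_act_closed: "(act M x ^^ m) v \<in> carrier M"
    and funpow_act_smult: "(act M x ^^ m) (c \<odot> v) = c \<odot> (act M x ^^ m) v"
proof -
  show closed: "(act M x ^^ m) v \<in> carrier M" for m using assms by (induction m) (simp_all add: act_closed)
  show "(act M x ^^ m) (c \<odot> v) = c \<odot> (act M x ^^ m) v"
    using closed by (induction m) (simp_all add: act_smult)
qed

lemma funpow_act_add:
  assumes "v \<in> carrier M" "w \<in> carrier M"
  shows "(act M x ^^ m) (v \<oplus> w) = (act M x ^^ m) v \<oplus> (act M x ^^ m) w"
  using assms by (induction m) (simp_all add: act_add funpow_act_closed)

lemma funpow_act_zero: "(act M x ^^ m) \<zero> = \<zero>"
  by (induction m) (simp_all add: act_zero)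

text \<open>The classical sl(2) formula, by induction from \<open>[X2, Y2] = H2\<close> and \<open>[H2, Y2] = - 2 Y2\<close>.\<close>

lemma act_X2_Y2_pow:
  assumes w: "w \<in> carrier M" "act M X2 w = \<zero>" "act M H2 w = c \<odot> w"
  shows "act M X2 ((act M Y2 ^^ Suc k) w) = ((of_nat k + 1) * (c - of_nat k)) \<odot> (act M Y2 ^^ k) w"
proof -
  let ?E = "\<lambda>k. (act M Y2 ^^ k) w"
  have E: "?E k \<in> carrier M" for k by (rule funpow_act_closed[OF w(1)])
  have H2: "act M H2 (?E k) = (c - 2 * of_nat k) \<odot> ?E k" for k
  proof (induction k)
    case (Suc k)
    have "superbracket H2 Y2 = scale_sl12 (- 2) Y2"
      by (simp add: sl12_entries)
    then have "act M H2 (act M Y2 (?E k)) = (- 2) \<odot> act M Y2 (?E k) \<oplus> act M Y2 (act M H2 (?E k))"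
      using act_swap[OF basis_homogeneous(8,6) E, of k] smult_one[of "act M Y2 (act M H2 (?E k))"]
      by (simp add: super_sign_def act_scale_left E act_closed del: sl12.scale_minus_left)
    also have "\<dots> = (- 2) \<odot> ?E (Suc k) \<oplus> (c - 2 * of_nat k) \<odot> ?E (Suc k)"
      by (simp add: Suc act_smult E)
    also have "\<dots> = (c - 2 * of_nat (Suc k)) \<odot> ?E (Suc k)"
      using smult_l_distr[of "- 2" "c - 2 * of_nat k" "?E (Suc k)"] E[of "Suc k"] by (simp add: algebra_simps)
    finally show ?case by simp
  qed (simp add: w)
  have step: "act M X2 (?E (Suc k)) = act M H2 (?E k) \<oplus> act M Y2 (act M X2 (?E k))" for k
    using act_swap[OF basis_homogeneous(5,6) E, of k] smult_one[of "act M Y2 (act M X2 (?E k))"]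
    by (simp add: super_sign_def superbracket_basis E act_closed)
  show ?thesis
  proof (induction k)
    case 0
    show ?case unfolding step H2 using E[of 0] by (simp add: w act_zero)
  next
    case (Suc k)
    have "act M X2 (?E (Suc (Suc k))) 
        = (c - 2 * of_nat (Suc k)) \<odot> ?E (Suc k) \<oplus> ((of_nat k + 1) * (c - of_nat k)) \<odot> ?E (Suc k)"
      unfolding step[of "Suc k"] H2 Suc by (simp add: act_smult E)
    also have "\<dots> = ((of_nat (Suc k) + 1) * (c - of_nat (Suc k))) \<odot> ?E (Suc k)"
      using smult_l_distr[of "c - 2 * of_nat (Suc k)" "(of_nat k + 1) * (c - of_nat k)" "?E (Suc k)"] E[of "Suc k"]
      by (simp add: algebra_simps)
    finally show ?case .
  qed
qed

text \<open>If \<open>c\<close> is not a natural number, \<open>X2\<^sup>m Y2\<^sup>m w\<close> is a nonzero multiple of \<open>w\<close> for every \<open>m\<close>, whereas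
  \<open>X2\<^sup>m Y2\<^sup>j w = 0\<close> for \<open>j < m\<close>.  The kernels of the powers of \<open>X2\<close> therefore separate the vectors
  \<open>Y2\<^sup>j w\<close>, and these are infinitely many independent vectors.\<close>

lemma fin_dim_X2_highest_weight_nat:
  assumes fin: fin_dim
    and w: "w \<in> carrier M" "w \<noteq> \<zero>" "act M X2 w = \<zero>" "act M H2 w = c \<odot> w"
  shows "c \<in> \<nat>"
proof (rule ccontr)
  assume c: "c \<notin> \<nat>"
  define g where "g k = (of_nat k + 1) * (c - of_nat k)" for k :: nat
  have g: "g k \<noteq> 0" for k
  proof -
    have "c \<noteq> of_nat k" using c by auto
    moreover have "of_nat k + 1 \<noteq> (0 :: complex)" by (metis of_nat_Suc of_nat_eq_0_iff add.commute nat.distinct(1))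
    ultimately show ?thesis by (simp add: g_def)
  qed
  let ?E = "\<lambda>k. (act M Y2 ^^ k) w" let ?X = "\<lambda>m. act M X2 ^^ m"
  have E: "?E k \<in> carrier M" for k by (rule funpow_act_closed[OF w(1)])
  have X_Suc: "?X (Suc m) (?E (Suc k)) = g k \<odot> ?X m (?E k)" for m k
    using act_X2_Y2_pow[OF w(1,3,4), of k]
    by (simp only: funpow_Suc_right comp_apply g_def funpow_act_smult[OF E])
  have kill: "?X m (?E j) = \<zero>" if "j < m" for m j
    using that
  proof (induction m arbitrary: j)
    case (Suc m)
    show ?case
    proof (cases j)
      case 0
      then show ?thesis using w(3) by (simp only: funpow_Suc_right comp_apply funpow_0) (simp add: funpow_act_zero)
    next
      case (Suc i)
      then show ?thesis using Suc.IH[of i] Suc.prems by (simp only: X_Suc) (simp add: smult_zero)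
    qed
  qed simp
  have survive: "?X m (?E m) \<noteq> \<zero>" for m
  proof (induction m)
    case (Suc m)
    then show ?case
      using smult_eq_zeroD[OF _ g funpow_act_closed[OF E]] by (simp only: X_Suc) blast
  qed (simp add: w)
  have indep: "lin_indpt (?E ` {..<m}) \<and> card (?E ` {..<m}) = m" for m
  proof (induction m)
    case 0
    show ?case by (auto simp: lin_dep_def)
  next
    case (Suc m)
    let ?S = "?E ` {..<m}"
    have S: "?S \<subseteq> carrier M" using E by blast
    let ?K = "{u \<in> carrier M. ?X m u = \<zero>}"
    have "submodule complex_ring ?K M"
      by standard (auto simp: funpow_act_add funpow_act_smult funpow_act_zero smult_zero)
    moreover have "?S \<subseteq> ?K" using E kill by blast
    ultimately have "span ?S \<subseteq> ?K" by (intro span_is_subset)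
    then have notin: "?E m \<notin> span ?S" using survive[of m] by blast
    then have "?E m \<notin> ?S" using in_own_span[OF S] by blast
    moreover have "lin_indpt (?S \<union> {?E m})"
      using lin_dep_iff_in_span[OF S _ E calculation] Suc notin by blast
    ultimately show ?case using Suc by (simp add: lessThan_Suc)
  qed
  have "card (?E ` {..<Suc dim}) \<le> dim"
    by (rule li_le_dim(2)[OF fin]) (use E indep in blast)+
  then show False using indep[of "Suc dim"] by simp
qed

text \<open>If \<open>\<mu> H2 = 0\<close>, the vector \<open>X1 v\<close> satisfies the hypotheses of the previous lemma with the eigenvalue
  \<open>- 1\<close> unless it is zero.  So it is zero, and \<open>H1 = [X1, Y1]\<close> kills \<open>v\<close>.\<close>

lemma fin_dim_highest_weight:
  assumes fin: fin_dim and weight: "\<mu> \<in> weights" and v: "highest_weight_vector M \<mu> v"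
  shows "\<mu> = zero_weight \<or> (\<exists>n::int. n \<ge> 1 \<and> \<mu> H2 = of_int n)"
proof -
  have basis: "Y1 \<in> n_plus" "X2 \<in> n_plus" "X3 \<in> n_plus" "H1 \<in> cartan" "H2 \<in> cartan"
    by (auto simp: n_plus_def cartan_def intro: sl12.span_base)
  have v': "v \<in> carrier M" "v \<noteq> \<zero>" "act M Y1 v = \<zero>" "act M X2 v = \<zero>" "act M X3 v = \<zero>"
    "act M H1 v = \<mu> H1 \<odot> v" "act M H2 v = \<mu> H2 \<odot> v"
    using v basis unfolding highest_weight_vector_def by auto
  obtain k where k: "\<mu> H2 = of_nat k"
    using fin_dim_X2_highest_weight_nat[OF fin v'(1,2,4,7)] by (auto elim: Nats_cases)
  show ?thesis
  proof (cases "k = 0")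
    case False
    then show ?thesis using k by (intro disjI2 exI[of _ "int k"]) simp
  next
    case True
    have neg: "act M (- x) u = (- 1) \<odot> act M x u" if "u \<in> carrier M" for x u
      using act_scale_left[OF that, of "- 1" x] by (simp add: sl12.scale_minus_left)
    have X1v: "act M X1 v \<in> carrier M" using v' by (simp add: act_closed)
    have "act M X2 (act M X1 v) = \<zero>"
      using act_swap[OF basis_homogeneous(5,1) v'(1)] v'
      by (simp add: superbracket_basis neg act_zero smult_zero)
    moreover have "act M H2 (act M X1 v) = (- 1) \<odot> act M X1 v"
      using act_swap[OF basis_homogeneous(8,1) v'(1)] v' X1v True k
      by (simp add: superbracket_basis neg act_zero smult_zero zero_smult)
    moreover have "(- 1 :: complex) \<notin> \<nat>"
    proof
      assume "(- 1 :: complex) \<in> \<nat>"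
      then obtain j where "(- 1 :: complex) = of_nat j" by (auto elim: Nats_cases)
      from arg_cong[OF this, of Re] show False by simp
    qed
    ultimately have "act M X1 v = \<zero>"
      using fin_dim_X2_highest_weight_nat[OF fin X1v] by blast
    then have "act M H1 v = \<zero>"
      using act_superbracket[OF basis_homogeneous(1,3) v'(1)] v'
      by (simp add: superbracket_basis act_zero smult_zero a_minus_def)
    then have "\<mu> H1 = 0" using v' smult_eq_zeroD by metis
    then have "\<mu> h = 0" if "h \<in> cartan" for h
      using that weights_cartan[OF weight] k True by (auto simp: cartan_eq)
    moreover have "\<mu> \<in> extensional cartan" using weight by (simp add: weights_def)
    ultimately have "\<mu> = zero_weight"
      unfolding zero_weight_def by (intro extensionalityI[of _ cartan]) auto
    then show ?thesis by blast
  qed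
qed

end

lemma zero_weight_in_weights: "zero_weight \<in> weights"
  unfolding weights_def zero_weight_def
  using sl12.span_add sl12.span_scale by (auto simp: cartan_def)

lemma kac_weight_of_int:
  assumes "\<mu> \<in> weights" "n \<ge> 1" "\<mu> H2 = of_int n"
  shows "kac_weight \<mu> (nat n) (\<mu> H1 / of_int n - 1)"
  using assms by unfold_locales (auto simp: of_nat_nat)

theorem proposition2p5:
  shows "P_plus = {\<mu> \<in> weights. \<exists>n::int. n \<ge> 1 \<and> \<mu> H2 = of_int n} \<union> {zero_weight}
    \<and> (\<forall>\<mu> \<in> P_plus - {zero_weight}.
         finite_dimensional (kac_module \<mu>) \<and> of_nat (module_dim (kac_module \<mu>)) = 4 * \<mu> H2)"
proof -
  let ?W = "{\<mu> \<in> weights. \<exists>n::int. n \<ge> 1 \<and> \<mu> H2 = of_int n}"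
  have "P_plus \<subseteq> ?W \<union> {zero_weight}"
  proof
    fix \<mu> assume "\<mu> \<in> P_plus"
    then obtain L :: "uea set supermodule" where \<mu>: "\<mu> \<in> weights" and L: "highest_weight_module L \<mu>" "finite_dimensional L"
      unfolding P_plus_def by blast
    then obtain v where "sl12_module L" "highest_weight_vector L \<mu> v"
      unfolding highest_weight_module_def by blast
    from sl12_module.fin_dim_highest_weight[OF this(1) L(2) \<mu> this(2)] \<mu> show "\<mu> \<in> ?W \<union> {zero_weight}" by blast
  qed
  moreover have "?W \<subseteq> P_plus"
    using kac_weight.irreducible_quotient_in_P_plus[OF kac_weight_of_int] by blast
  moreover have "zero_weight \<in> P_plus"
  proof -
    have "H1 \<in> cartan" "H2 \<in> cartan" by (auto simp: cartan_def intro: sl12.span_base)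
    then have "kac_weight zero_weight 0 0"
      by (intro kac_weight.intro zero_weight_in_weights) (simp_all add: zero_weight_def)
    then show ?thesis by (rule kac_weight.irreducible_quotient_in_P_plus)
  qed
  ultimately have P_plus: "P_plus = ?W \<union> {zero_weight}" by blast
  moreover have "finite_dimensional (kac_module \<mu>) \<and> of_nat (module_dim (kac_module \<mu>)) = 4 * \<mu> H2"
    if \<mu>: "\<mu> \<in> P_plus - {zero_weight}" for \<mu>
  proof -
    obtain n :: int where n: "\<mu> \<in> weights" "n \<ge> 1" "\<mu> H2 = of_int n"
      using \<mu> unfolding P_plus by blast
    note k = kac_weight_of_int[OF n]
    show ?thesis
      using kac_weight.kac_module_fin_dim[OF k] kac_weight.kac_module_dim[OF k] n by (simp add: of_nat_nat)
  qed
  ultimately show ?thesis by blast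
qed


end
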